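(* Let $\mathcal{F}\subset\mathcal{C}$ be a locally sliceable subset such that $D^{-1}(D(\mathcal{F}))$ is dense in $\mathcal{C}$, and let $\sigma:\mathbb{R}\to\mathbb{R}$ be an activation function of sigmoidal type. If the set $$\{X\in D(\mathcal{F}) : \mathcal{F}(X)\text{ separates }B(X)\text{ and }\mathbb{R}\mathcal{F}(X)\subset\mathcal{F}(X)\}$$ is dense in $D(\mathcal{F})$ (with respect to $d_{GH}$), then the shallow neural network $\mathcal{N}_\sigma(\mathcal{F})$ generated by $\sigma$ and $\mathcal{F}$ is dense in $\mathcal{C}$ (with respect to $d_{GH^0}$).
   Context: Metric spaces are nonempty. $\mathcal{M}$ is the collection of all compact metric spaces. For a metric space $X$, $\mathcal{C}(X)$ is the set of continuous functions $f:X\to\mathbb{R}$, and $\|f\|_\infty=\sup_{x\in X}|f(x)|$. Put $\mathcal{C}=\bigcup_{X\in\mathcal{M}}\mathcal{C}(X)$; the domain map $D:\mathcal{C}\to\mathcal{M}$ sends $f$ to its domain. For $\mathcal{F}\subset\mathcal{C}$ and $X\in\mathcal{M}$, $\mathcal{F}(X)=\mathcal{F}\cap\mathcal{C}(X)$; thus $D(\mathcal{F})=\{X\in\mathcal{M}:\mathcal{F}(X)\neq\emptyset\}$ and $D^{-1}(D(\mathcal{F}))=\bigcup_{X\in D(\mathcal{F})}\mathcal{C}(X)$. An activation function is a continuous function $\sigma:\mathbb{R}\to\mathbb{R}$; it is of sigmoidal type if $\lim_{t\to-\infty}\sigma(t)=0$ and $\lim_{t\to\infty}\sigma(t)=1$.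 For $F\subset\mathcal{C}(X)$, $N_\sigma(F)$ is $\emptyset$ if $F=\emptyset$, and otherwise the collection of functions $g:X\to\mathbb{R}$ of the form $g(x)=\sum_{j=1}^N a_j\sigma(f_j(x)+\theta_j)$ for all $x\in X$, with $N\in\mathbb{N}$, $a_j,\theta_j\in\mathbb{R}$, $f_j\in F$. For $\mathcal{F}\subset\mathcal{C}$, the shallow neural network generated by $\sigma$ and $\mathcal{F}$ is $\mathcal{N}_\sigma(\mathcal{F})=\bigcup_{X\in\mathcal{M}}N_\sigma(\mathcal{F}(X))$. For $X,Y\in\mathcal{M}$ and $\epsilon>0$, a (not necessarily continuous) map $i:X\to Y$ is an $\epsilon$-isometry if $|d(i(x),i(x'))-d(x,x')|\le\epsilon$ for all $x,x'\in X$, and for every $y\in Y$ there is $x\in X$ with $d(i(x),y)\le\epsilon$. The Gromov-Hausdorff distance on $\mathcal{M}$ is $d_{GH}(X,Y)=\inf\{\epsilon>0:$ there exist $\epsilon$-isometries $X\to Y$ and $Y\to X\}$. The $C^0$-Gromov-Hausdorff distance on $\mathcal{C}$ is $d_{GH^0}(f,g)=\inf\{\epsilon>0:$ there exist $\epsilon$-isometries $i:D(f)\to D(g)$ and $j:D(g)\to D(f)$ with $\|g\circ i-f\|_\infty\le\epsilon$ and $\|g-f\circ j\|_\infty\le\epsilon\}$. Both distances generate topologies via their open balls (a set is open iff it contains an open ball around each of its points); subsets of $\mathcal{M}$ and $\mathcal{C}$ carry the subspace topologies. Density in $\mathcal{C}$ is with respect to $d_{GH^0}$. $B(X)$ is the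 set of (finite) regular signed Borel measures on $X$. For $\mu\in B(X)$ and $f\in\mathcal{C}(X)$, $f_*(\mu)=\mu\circ f^{-1}$ is the pushforward measure on $\mathbb{R}$. A set $F\subset\mathcal{C}(X)$ separates $B(X)$ if for $\mu\in B(X)$: $f_*(\mu)=0$ for all $f\in F$ implies $\mu=0$. The condition $\mathbb{R}F\subset F$ means $\lambda f\in F$ for all $\lambda\in\mathbb{R}$, $f\in F$. A subset $\mathcal{F}\subset\mathcal{C}$ is locally sliceable if for every $X\in D(\mathcal{F})$, every $f\in\mathcal{C}(X)$ and every neighborhood $U$ of $f$ in $D^{-1}(D(\mathcal{F}))$ (topology from $d_{GH^0}$) there is a neighborhood $W$ of $X$ in $D(\mathcal{F})$ (topology from $d_{GH}$) such that $\mathcal{C}(X')\cap U\neq\emptyset$ for every $X'\in W$. *)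

theory Defs
  imports "HOL-Analysis.Analysis"
begin

section \<open>Compact metric spaces and their continuous functions\<close>

text \<open>
  HOL has no class of all sets, so the carriers of the spaces are the subsets of a universe
  \<open>'a\<close>, which stays an arbitrary type throughout. A compact metric space has at
  most continuum many points, so every \<open>'a\<close> at least as large as the reals contains an
  isometric copy of every compact metric space.

  A value of type \<open>'a metric\<close> may have an empty carrier, and it carries a distance function
  on all of \<open>'a\<close>. The last condition below fixes the irrelevant values off the carrier, so
  that a metric space has exactly one representative.
\<close>

definition compact_mspaces :: "'a metric set" where
  "compact_mspaces =
     {X. mspace X \<noteq> {} \<and> compact_space (mtopology_of X) \<and>
         (\<forall>x y. \<not> (x \<in> mspace X \<and> y \<in> mspace X) \<longrightarrow> mdist X x y = 0)}"

text \<open>A function on \<open>X\<close> is represented by its extension that is undefined off the carrier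
  (\<^const>\<open>extensional\<close>), so that equality is equality on \<open>X\<close>.\<close>

definition cont_funs :: "'a metric \<Rightarrow> ('a \<Rightarrow> real) set" where
  "cont_funs X =
     {f \<in> extensional (mspace X). continuous_map (mtopology_of X) euclideanreal f}"

text \<open>An element of the union of all \<open>cont_funs X\<close> has to remember its domain, as a metric
  space; hence the pairs. The domain map is \<^const>\<open>fst\<close>.\<close>

definition all_cont_funs :: "('a metric \<times> ('a \<Rightarrow> real)) set" where
  "all_cont_funs = (SIGMA X:compact_mspaces. cont_funs X)"

definition slice ::
  "('a metric \<times> ('a \<Rightarrow> real)) set \<Rightarrow> 'a metric \<Rightarrow> ('a \<Rightarrow> real) set" where
  "slice \<F> X = {f \<in> cont_funs X. (X, f) \<in> \<F>}"

definition domains :: "('a metric \<times> ('a \<Rightarrow> real)) set \<Rightarrow> 'a metric set" where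
  "domains \<F> = fst ` \<F>"

definition over_domains ::
  "('a metric \<times> ('a \<Rightarrow> real)) set \<Rightarrow> ('a metric \<times> ('a \<Rightarrow> real)) set" where
  "over_domains \<F> = {p \<in> all_cont_funs. fst p \<in> domains \<F>}"

definition sup_norm :: "'a metric \<Rightarrow> ('a \<Rightarrow> real) \<Rightarrow> real" where
  "sup_norm X h = (SUP x\<in>mspace X. \<bar>h x\<bar>)"


section \<open>Shallow neural networks\<close>

definition activation :: "(real \<Rightarrow> real) \<Rightarrow> bool" where
  "activation \<sigma> \<longleftrightarrow> continuous_on UNIV \<sigma>"

definition sigmoidal_type :: "(real \<Rightarrow> real) \<Rightarrow> bool" where
  "sigmoidal_type \<sigma> \<longleftrightarrow> (\<sigma> \<longlongrightarrow> 0) at_bot \<and> (\<sigma> \<longlongrightarrow> 1) at_top"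

definition network_on ::
  "(real \<Rightarrow> real) \<Rightarrow> 'a metric \<Rightarrow> ('a \<Rightarrow> real) set \<Rightarrow> ('a \<Rightarrow> real) set" where
  "network_on \<sigma> X F =
     (if F = {} then {}
      else {g. \<exists>(N::nat) (a :: nat \<Rightarrow> real) (\<theta> :: nat \<Rightarrow> real) (f :: nat \<Rightarrow> 'a \<Rightarrow> real).
                 (\<forall>j\<in>{1..N}. f j \<in> F) \<and>
                 g = restrict (\<lambda>x. \<Sum>j=1..N. a j * \<sigma> (f j x + \<theta> j)) (mspace X)})"

definition network ::
  "(real \<Rightarrow> real) \<Rightarrow> ('a metric \<times> ('a \<Rightarrow> real)) set \<Rightarrow> ('a metric \<times> ('a \<Rightarrow> real)) set" where
  "network \<sigma> \<F> = (SIGMA X:compact_mspaces. network_on \<sigma> X (slice \<F> X))"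


section \<open>Gromov-Hausdorff distances and their topologies\<close>

definition eps_isometry :: "real \<Rightarrow> 'a metric \<Rightarrow> 'a metric \<Rightarrow> ('a \<Rightarrow> 'a) \<Rightarrow> bool" where
  "eps_isometry \<epsilon> X Y i \<longleftrightarrow>
     i \<in> mspace X \<rightarrow> mspace Y \<and>
     (\<forall>x\<in>mspace X. \<forall>x'\<in>mspace X. \<bar>mdist Y (i x) (i x') - mdist X x x'\<bar> \<le> \<epsilon>) \<and>
     (\<forall>y\<in>mspace Y. \<exists>x\<in>mspace X. mdist Y (i x) y \<le> \<epsilon>)"

definition GH_dist :: "'a metric \<Rightarrow> 'a metric \<Rightarrow> real" where
  "GH_dist X Y =
     Inf {\<epsilon>. \<epsilon> > 0 \<and> (\<exists>i. eps_isometry \<epsilon> X Y i) \<and> (\<exists>j. eps_isometry \<epsilon> Y X j)}"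

definition GH0_dist :: "'a metric \<times> ('a \<Rightarrow> real) \<Rightarrow> 'a metric \<times> ('a \<Rightarrow> real) \<Rightarrow> real" where
  "GH0_dist = (\<lambda>(X, f) (Y, g).
     Inf {\<epsilon>. \<epsilon> > 0 \<and>
       (\<exists>i j. eps_isometry \<epsilon> X Y i \<and> eps_isometry \<epsilon> Y X j \<and>
              sup_norm X (\<lambda>x. g (i x) - f x) \<le> \<epsilon> \<and>
              sup_norm Y (\<lambda>y. g y - f (j y)) \<le> \<epsilon>)})"

text \<open>The two distances satisfy the triangle inequality only up to a constant factor, so
  \<^const>\<open>Metric_space.mtopology\<close> does not apply, and an open ball need not be an open set.\<close>

definition ball_open :: "'b set \<Rightarrow> ('b \<Rightarrow> 'b \<Rightarrow> real) \<Rightarrow> 'b set \<Rightarrow> bool" where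
  "ball_open S d U \<longleftrightarrow> U \<subseteq> S \<and> (\<forall>x\<in>U. \<exists>r>0. {y \<in> S. d x y < r} \<subseteq> U)"

definition ball_topology :: "'b set \<Rightarrow> ('b \<Rightarrow> 'b \<Rightarrow> real) \<Rightarrow> 'b topology" where
  "ball_topology S d = topology (ball_open S d)"

lemma istopology_ball_open: "istopology (ball_open S d)"
  unfolding istopology_def
proof (intro conjI allI impI)
  fix U V assume U: "ball_open S d U" and V: "ball_open S d V"
  have "\<exists>r>0. {y \<in> S. d x y < r} \<subseteq> U \<inter> V" if x: "x \<in> U \<inter> V" for x
  proof -
    obtain r where r: "r > 0" "{y \<in> S. d x y < r} \<subseteq> U"
      using U x unfolding ball_open_def by blast
    obtain s where s: "s > 0" "{y \<in> S. d x y < s} \<subseteq> V"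
      using V x unfolding ball_open_def by blast
    have "min r s > 0"
      using r(1) s(1) by simp
    moreover have "{y \<in> S. d x y < min r s} \<subseteq> U \<inter> V"
      using r(2) s(2) by (simp add: subset_iff)
    ultimately show ?thesis by blast
  qed
  moreover have "U \<inter> V \<subseteq> S"
    using U unfolding ball_open_def by blast
  ultimately show "ball_open S d (U \<inter> V)"
    unfolding ball_open_def by blast
next
  fix \<K> assume K: "\<forall>K\<in>\<K>. ball_open S d K"
  have "\<exists>r>0. {y \<in> S. d x y < r} \<subseteq> \<Union>\<K>" if x: "x \<in> \<Union>\<K>" for x
  proof -
    obtain K where "K \<in> \<K>" "x \<in> K"
      using x by blast
    moreover from this obtain r where "r > 0" "{y \<in> S. d x y < r} \<subseteq> K"
      using K unfolding ball_open_def by blast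
    ultimately show ?thesis by blast
  qed
  moreover have "\<Union>\<K> \<subseteq> S"
    using K unfolding ball_open_def by blast
  ultimately show "ball_open S d (\<Union>\<K>)"
    unfolding ball_open_def by blast
qed

lemma openin_ball_topology: "openin (ball_topology S d) U \<longleftrightarrow> ball_open S d U"
  by (simp add: ball_topology_def istopology_ball_open)

lemma topspace_ball_topology [simp]: "topspace (ball_topology S d) = S"
proof -
  have "ball_open S d S"
    unfolding ball_open_def using zero_less_one by blast
  moreover have "U \<subseteq> S" if "ball_open S d U" for U
    using that unfolding ball_open_def by blast
  ultimately show ?thesis
    unfolding topspace_def openin_ball_topology by blast
qed

definition GH_topology :: "'a metric topology" where
  "GH_topology = ball_topology compact_mspaces GH_dist"

definition GH0_topology :: "('a metric \<times> ('a \<Rightarrow> real)) topology" where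
  "GH0_topology = ball_topology all_cont_funs GH0_dist"

definition dense_in :: "'b topology \<Rightarrow> 'b set \<Rightarrow> bool" where
  "dense_in T A \<longleftrightarrow> A \<subseteq> topspace T \<and> T closure_of A = topspace T"

definition neighborhood :: "'b topology \<Rightarrow> 'b \<Rightarrow> 'b set \<Rightarrow> bool" where
  "neighborhood T x U \<longleftrightarrow> U \<subseteq> topspace T \<and> (\<exists>V. openin T V \<and> x \<in> V \<and> V \<subseteq> U)"

definition locally_sliceable :: "('a metric \<times> ('a \<Rightarrow> real)) set \<Rightarrow> bool" where
  "locally_sliceable \<F> \<longleftrightarrow>
     (\<forall>X\<in>domains \<F>. \<forall>f\<in>cont_funs X. \<forall>U.
        neighborhood (subtopology GH0_topology (over_domains \<F>)) (X, f) U \<longrightarrow>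
        (\<exists>W. neighborhood (subtopology GH_topology (domains \<F>)) X W \<and>
             (\<forall>X'\<in>W. \<exists>g\<in>cont_funs X'. (X', g) \<in> U)))"


section \<open>Regular signed Borel measures\<close>

definition borel_sets_of :: "'a metric \<Rightarrow> 'a set set" where
  "borel_sets_of X = sigma_sets (mspace X) {U. openin (mtopology_of X) U}"

text \<open>Finiteness of a signed measure is built in, as its values are real numbers. Its values on
  non-Borel sets are irrelevant, and equality of measures means equality on Borel sets.\<close>

definition signed_measure :: "'a metric \<Rightarrow> ('a set \<Rightarrow> real) \<Rightarrow> bool" where
  "signed_measure X \<mu> \<longleftrightarrow>
     \<mu> {} = 0 \<and>
     (\<forall>A :: nat \<Rightarrow> 'a set. range A \<subseteq> borel_sets_of X \<longrightarrow> disjoint_family A \<longrightarrow>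
        (\<lambda>n. \<mu> (A n)) sums \<mu> (\<Union>n. A n))"

definition variation :: "'a metric \<Rightarrow> ('a set \<Rightarrow> real) \<Rightarrow> 'a set \<Rightarrow> ennreal" where
  "variation X \<mu> E =
     (SUP P \<in> {P. finite P \<and> P \<subseteq> borel_sets_of X \<and> disjoint P \<and> \<Union>P = E}.
        \<Sum>A\<in>P. ennreal \<bar>\<mu> A\<bar>)"

text \<open>A signed measure is regular if its total variation is outer regular with respect to open
  sets and inner regular with respect to compact sets.\<close>

definition regular_measure :: "'a metric \<Rightarrow> ('a set \<Rightarrow> real) \<Rightarrow> bool" where
  "regular_measure X \<mu> \<longleftrightarrow>
     (\<forall>E\<in>borel_sets_of X.
        variation X \<mu> E = (INF U \<in> {U. openin (mtopology_of X) U \<and> E \<subseteq> U}. variation X \<mu> U) \<and>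
        variation X \<mu> E = (SUP K \<in> {K. compactin (mtopology_of X) K \<and> K \<subseteq> E}. variation X \<mu> K))"

definition regular_signed_measures :: "'a metric \<Rightarrow> ('a set \<Rightarrow> real) set" where
  "regular_signed_measures X = {\<mu>. signed_measure X \<mu> \<and> regular_measure X \<mu>}"

definition pushforward :: "'a metric \<Rightarrow> ('a \<Rightarrow> real) \<Rightarrow> ('a set \<Rightarrow> real) \<Rightarrow> real set \<Rightarrow> real" where
  "pushforward X f \<mu> B = \<mu> (f -` B \<inter> mspace X)"

definition separates_measures :: "'a metric \<Rightarrow> ('a \<Rightarrow> real) set \<Rightarrow> bool" where
  "separates_measures X F \<longleftrightarrow>
     (\<forall>\<mu>\<in>regular_signed_measures X.
        (\<forall>f\<in>F. \<forall>B\<in>sets (borel :: real measure). pushforward X f \<mu> B = 0) \<longrightarrow>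
        (\<forall>E\<in>borel_sets_of X. \<mu> E = 0))"

definition closed_under_scaling :: "'a metric \<Rightarrow> ('a \<Rightarrow> real) set \<Rightarrow> bool" where
  "closed_under_scaling X F \<longleftrightarrow>
     (\<forall>c::real. \<forall>f\<in>F. restrict (\<lambda>x. c * f x) (mspace X) \<in> F)"

end

theory Submission
  imports Defs "HOL-Probability.Probability"
begin

text \<open>
  By local sliceability and density it suffices to approximate uniformly on a single compact space
  \<open>X\<close> in the dense set: a uniformly close function on the same domain is close in the
  \<open>C\<^sup>0\<close>-Gromov-Hausdorff distance, with the identity as isometry.

  On \<open>X\<close> the argument is Cybenko's. If the networks are not dense, the Hahn-Banach theorem gives
  a functional that vanishes on them but not everywhere. A signed measure representing it has zero
  pushforward under each \<open>f\<close> in the family, since \<open>\<sigma> (n\<^sup>2 (f - c) - n)\<close> tends to the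
  indicator of \<open>f > c\<close>; so it vanishes, a contradiction.

  The representing measure is obtained without the Riesz theorem: \<open>X\<close> is the continuous image of
  a compact \<open>K \<subseteq> {0..1}\<close>, the functional is lifted to \<open>K\<close>, where Helly's selection theorem
  yields the measure as a limit of finite sums of atoms, and the measure is pushed forward to \<open>X\<close>.
\<close>

section \<open>Compact metric spaces as images of compact sets of reals\<close>

text \<open>The separation hypothesis tests regular signed measures only, so the representing
  measure must also be shown regular. This is inherited from the line, where finite Borel measures
  are inner regular, because \<open>\<phi>\<close> maps compact sets to compact sets. The map
  \<open>\<phi>\<close> need not be injective: the Hahn-Banach step runs over all bounded continuous
  functions on the line, in the seminorm given by the supremum over \<open>K\<close>, and only those
  that agree on \<open>K\<close> with some \<open>k \<circ> \<phi>\<close> are compared with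
  functions on \<open>X\<close>.

  Closure under scaling has one purpose, to admit the unbounded slopes in Cybenko's argument. Local
  sliceability is needed because a domain that meets the given open set need not itself be one where
  the family separates measures; it provides a function in the open set on every nearby domain,
  hence on a good one.\<close>

definition ternary :: "(nat \<Rightarrow> bool) \<Rightarrow> real" where
  "ternary b = (\<Sum>k. of_bool (b k) / 3 ^ Suc k)"

lemma sums_geometric_third: "(\<lambda>k. 1 / 3 ^ Suc k) sums (1 / 2 :: real)"
  using sums_mult[OF geometric_sums[of "1 / 3 :: real"], of "1 / 3"]
  by (simp add: power_divide)

lemma summable_ternary: "summable (\<lambda>k. of_bool (b k) / 3 ^ Suc k :: real)"
  by (rule summable_comparison_test'[OF sums_summable[OF sums_geometric_third]]) auto

lemma ternary_bounds: "ternary b \<in> {0..1}"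
proof -
  have "ternary b \<le> (\<Sum>k. 1 / 3 ^ Suc k)"
    unfolding ternary_def
    by (intro suminf_le summable_ternary sums_summable[OF sums_geometric_third]) auto
  moreover have "ternary b \<ge> 0"
    unfolding ternary_def by (intro suminf_nonneg summable_ternary) auto
  ultimately show ?thesis
    using sums_geometric_third by (simp add: sums_iff)
qed

text \<open>Base three with digits 0 and 1 leaves gaps: all digits after position \<open>k\<close>
  together weigh at most half of digit \<open>k\<close>. Base two would identify some sequences. The
  range is the Cantor set scaled by one half.\<close>

lemma ternary_less:
  assumes eq: "\<And>j. j < k \<Longrightarrow> b j = c j" and "\<not> b k" "c k"
  shows "ternary b < ternary c"
proof -
  have split: "ternary d = (\<Sum>j<k. of_bool (d j) / 3 ^ Suc j) + of_bool (d k) / 3 ^ Suc k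
                 + (1 / 3 ^ Suc k) * ternary (\<lambda>j. d (j + Suc k))" for d
    unfolding ternary_def suminf_split_initial_segment[OF summable_ternary, of d "Suc k"]
    by (subst suminf_mult[symmetric, OF summable_ternary]) (simp add: power_add mult_ac)
  have "ternary (\<lambda>j. b (j + Suc k)) \<le> (\<Sum>k. 1 / 3 ^ Suc k)"
    unfolding ternary_def
    by (intro suminf_le summable_ternary sums_summable[OF sums_geometric_third]) auto
  then have "(1 / 3 ^ Suc k) * ternary (\<lambda>j. b (j + Suc k)) \<le> (1 / 3 ^ Suc k) * (1 / 2)"
    using sums_geometric_third by (intro mult_left_mono) (auto simp: sums_iff)
  moreover have "(1 / 3 ^ Suc k) * ternary (\<lambda>j. c (j + Suc k)) \<ge> 0"
    using ternary_bounds by simp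
  moreover have "(1 / 3 ^ Suc k) * (1 / 2) < (1 / 3 ^ Suc k :: real)"
    by (simp add: field_simps)
  moreover have "(\<Sum>j<k. of_bool (b j) / 3 ^ Suc j) = (\<Sum>j<k. of_bool (c j) / 3 ^ Suc j :: real)"
    using eq by (intro sum.cong) auto
  ultimately show ?thesis
    unfolding split[of b] split[of c] using assms(2,3) by simp
qed

lemma inj_ternary: "inj ternary"
proof (rule injI, rule ccontr)
  fix b c assume eq: "ternary b = ternary c" and "b \<noteq> c"
  then obtain i where "b i \<noteq> c i" by blast
  define k where "k = (LEAST i. b i \<noteq> c i)"
  have k: "b k \<noteq> c k" unfolding k_def by (rule LeastI, fact)
  have "b j = c j" if "j < k" for j
    using that not_less_Least unfolding k_def by blast
  then show False
    using ternary_less[of k b c] ternary_less[of k c b] k eq by (cases "b k") auto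
qed

lemma continuous_on_ternary: "continuous_on UNIV ternary"
proof -
  have "continuous_on UNIV (\<lambda>b. \<Sum>k<n. of_bool (b k) / 3 ^ Suc k :: real)" for n
  proof (intro continuous_intros)
    fix k
    have "continuous_on UNIV ((of_bool :: bool \<Rightarrow> real) \<circ> (\<lambda>b :: nat \<Rightarrow> bool. b k))"
      by (intro continuous_on_compose continuous_on_product_coordinates) simp
    then show "continuous_on UNIV (\<lambda>b :: nat \<Rightarrow> bool. of_bool (b k) :: real)"
      by (simp add: o_def)
  qed auto
  moreover have "uniform_limit UNIV (\<lambda>n b. \<Sum>k<n. of_bool (b k) / 3 ^ Suc k :: real)
      ternary sequentially"
    unfolding ternary_def[abs_def]
    by (rule Weierstrass_m_test[OF _ sums_summable[OF sums_geometric_third]]) auto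
  ultimately show ?thesis
    by (intro uniform_limit_theorem[where F = sequentially]) auto
qed

text \<open>Tychonoff: the function type carries the product topology, and each factor is
  finite.\<close>

lemma compact_space_bool_sequences: "compact_space (euclidean :: (nat \<Rightarrow> bool) topology)"
proof -
  have "compact_space (euclidean :: bool topology)"
    by (simp add: compact_space_def finite_imp_compact)
  then show ?thesis
    by (simp add: compact_space_product_topology flip: euclidean_product_topology)
qed

text \<open>The union of finite \<open>1 / Suc m\<close>-nets. A sequence, possibly with
  repetitions, is wanted because its indices will number the bits.\<close>

lemma compact_metric_space_dense_sequence:
  assumes "compact_space (mtopology_of X)" "mspace X \<noteq> {}"
  obtains s :: "nat \<Rightarrow> 'a"
  where "range s \<subseteq> mspace X" "\<And>x e. x \<in> mspace X \<Longrightarrow> e > 0 \<Longrightarrow> \<exists>n. mdist X (s n) x < e"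
proof -
  interpret Metric_space "mspace X" "mdist X" by simp
  have "mtotally_bounded (mspace X)"
    using assms(1) compactin_imp_mtotally_bounded
    by (simp add: compact_space_def mtopology_of_def)
  then have "\<forall>e>0. \<exists>K. finite K \<and> K \<subseteq> mspace X \<and> mspace X \<subseteq> (\<Union>x\<in>K. mball x e)"
    by (simp add: mtotally_bounded_def)
  then have "\<forall>m. \<exists>K. finite K \<and> K \<subseteq> mspace X \<and> mspace X \<subseteq> (\<Union>x\<in>K. mball x (1 / Suc m))"
    by simp
  then obtain K where K: "\<And>m::nat. finite (K m)" "\<And>m. K m \<subseteq> mspace X"
      "\<And>m. mspace X \<subseteq> (\<Union>x\<in>K m. mball x (1 / Suc m))"
    by metis
  define S where "S = (\<Union>m. K m)"
  have "S \<noteq> {}" using K(3)[of 0] assms(2) by (auto simp: S_def)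
  moreover have "countable S"
    unfolding S_def using K(1) by (simp add: countable_finite)
  ultimately have r: "range (from_nat_into S) = S"
    by (rule range_from_nat_into)
  show ?thesis
  proof
    show "range (from_nat_into S) \<subseteq> mspace X"
      unfolding r using K(2) by (auto simp: S_def)
    fix x and e :: real assume x: "x \<in> mspace X" and e: "e > 0"
    obtain m where m: "1 / real (Suc m) < e"
      using nat_approx_posE[OF e] by auto
    obtain y where y: "y \<in> K m" "x \<in> mball y (1 / Suc m)"
      using K(3)[of m] x by auto
    obtain n where "from_nat_into S n = y"
      using r y(1) by (metis S_def UNIV_I UN_iff imageE)
    then show "\<exists>n. mdist X (from_nat_into S n) x < e"
      using y(2) m by (intro exI[of _ n]) auto
  qed
qed

text \<open>A bit sequence records, for countably many pairs of closed sets covering \<open>X\<close>, a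
  half containing the point; the pairs separate points, so the sequence determines the point.\<close>

lemma compact_metric_space_image_of_real_compact:
  assumes X: "compact_space (mtopology_of X)" "mspace X \<noteq> {}"
  obtains K :: "real set" and \<phi> where "compact K" "K \<subseteq> {0..1}"
    "continuous_map (top_of_set K) (mtopology_of X) \<phi>" "\<phi> ` K = mspace X"
proof -
  interpret Metric_space "mspace X" "mdist X" by simp
  obtain s :: "nat \<Rightarrow> 'a" where s: "range s \<subseteq> mspace X"
      "\<And>x e. x \<in> mspace X \<Longrightarrow> e > 0 \<Longrightarrow> \<exists>n. mdist X (s n) x < e"
    using compact_metric_space_dense_sequence[OF X] by blast
  \<comment> \<open>Each index codes a pair of a centre and a radius, so that every ball of radius
    \<open>1 / Suc m\<close> about a point of the sequence has its own bit.\<close>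
  define a where "a i = s (fst (prod_decode i))" for i
  define q where "q i = 1 / real (Suc (snd (prod_decode i)))" for i
  have a: "a i \<in> mspace X" for i using s(1) by (auto simp: a_def)
  \<comment> \<open>The halves overlap on the sphere of radius \<open>q i\<close>. Both have to be
    closed for \<open>R\<close> to be closed; a point may then have several sequences, which is
    harmless because the map runs from sequences to points.\<close>
  define B where "B = (\<lambda>(b, i). if b then {x \<in> mspace X. mdist X (a i) x \<le> q i}
                                   else {x \<in> mspace X. mdist X (a i) x \<ge> q i})"
  have B_closed: "closedin (mtopology_of X) (B (b, i))" for b i
  proof -
    have c: "continuous_map mtopology euclideanreal (\<lambda>x. mdist X (a i) x)"
      using a by (intro continuous_map_mdist) (auto simp: mtopology_of_def)
    show ?thesis
      using closedin_continuous_map_preimage[OF c, of "{..q i}"]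
        closedin_continuous_map_preimage[OF c, of "{q i..}"]
      by (auto simp: B_def mtopology_of_def)
  qed
  \<comment> \<open>The graph of that map. Its domain is a proper subset in general, since the
    halves chosen by a sequence may have empty intersection.\<close>
  define R where "R = {(b, x). x \<in> mspace X \<and> (\<forall>i. x \<in> B (b i, i))}"
  have R_unique: "x = y" if "(b, x) \<in> R" "(b, y) \<in> R" for b x y
  proof (rule ccontr)
    assume "x \<noteq> y"
    have xy: "x \<in> mspace X" "y \<in> mspace X" using that by (auto simp: R_def)
    with \<open>x \<noteq> y\<close> have d: "mdist X x y / 2 > 0" by simp
    \<comment> \<open>Half the distance, so that a centre closer than \<open>1 / Suc m\<close> to
      \<open>x\<close> is farther than \<open>1 / Suc m\<close> from \<open>y\<close>:
      \<open>x\<close> is strictly inside, \<open>y\<close> strictly outside, and no bit fits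
      both.\<close>
    obtain m where m: "1 / real (Suc m) < mdist X x y / 2"
      using nat_approx_posE[OF d] by auto
    obtain n where n: "mdist X (s n) x < 1 / real (Suc m)"
      using s(2)[OF xy(1), of "1 / real (Suc m)"] by auto
    define i where "i = prod_encode (n, m)"
    have i: "a i = s n" "q i = 1 / real (Suc m)" by (auto simp: i_def a_def q_def)
    have "mdist X x y \<le> mdist X (a i) x + mdist X (a i) y"
      using triangle[of x "a i" y] xy a[of i] commute[of "a i" x] by simp
    then have "mdist X (a i) y > q i" "mdist X (a i) x < q i" using m n i by auto
    moreover have "x \<in> B (b i, i)" "y \<in> B (b i, i)" using that by (auto simp: R_def)
    ultimately show False by (auto simp: B_def split: if_splits)
  qed
  have R_total: "\<exists>b. (b, x) \<in> R" if "x \<in> mspace X" for x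
    using that by (intro exI[of _ "\<lambda>i. mdist X (a i) x \<le> q i"]) (auto simp: R_def B_def)
  let ?P = "prod_topology (euclidean :: (nat \<Rightarrow> bool) topology) (mtopology_of X)"
  have R_closed: "closedin ?P R"
  proof -
    have "closedin ?P (({b. b i} \<times> B (True, i)) \<union> ({b. \<not> b i} \<times> B (False, i)))" for i
    proof -
      have "closed ((\<lambda>b :: nat \<Rightarrow> bool. b i) -` V)" for V
        by (intro closed_vimage continuous_on_product_coordinates)
           (simp add: closed_def discrete_topology_class.open_discrete)
      from this[of "{True}"] this[of "{False}"]
      have "closed {b :: nat \<Rightarrow> bool. b i}" "closed {b :: nat \<Rightarrow> bool. \<not> b i}"
        by (auto simp: vimage_def)
      then show ?thesis
        using B_closed by (intro closedin_Un) (auto simp: closedin_prod_Times_iff)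
    qed
    then have "closedin ?P (\<Inter>i. ({b. b i} \<times> B (True, i)) \<union> ({b. \<not> b i} \<times> B (False, i)))"
      by (intro closedin_INT) auto
    also have "(\<Inter>i. ({b. b i} \<times> B (True, i)) \<union> ({b. \<not> b i} \<times> B (False, i))) = R"
      unfolding R_def by (auto simp: B_def split: if_splits)
    finally show ?thesis .
  qed
  \<comment> \<open>Wanted for every closed \<open>F\<close>: the preimage of \<open>F\<close> under
    \<open>\<phi>\<close> is the image of this set under \<open>ternary \<circ> fst\<close>, hence
    compact and closed. This is the continuity of \<open>\<phi>\<close>.\<close>
  have R_compact: "compactin ?P (R \<inter> (UNIV \<times> F))" if "closedin (mtopology_of X) F" for F
  proof -
    have "compact_space ?P"
      using X(1) compact_space_bool_sequences by (simp add: compact_space_prod_topology)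
    moreover have "closedin ?P (R \<inter> (UNIV \<times> F))"
      using R_closed that by (intro closedin_Int) (auto simp: closedin_prod_Times_iff)
    ultimately show ?thesis by (rule closedin_compact_space)
  qed
  have cont: "continuous_map ?P euclideanreal (ternary \<circ> fst)"
    using continuous_on_ternary by (intro continuous_map_compose[OF continuous_map_fst]) auto
  have image_compact: "compact (ternary ` fst ` (R \<inter> (UNIV \<times> F)))"
    if "closedin (mtopology_of X) F" for F
    using image_compactin[OF R_compact[OF that] cont] by (simp add: image_comp)
  define K where "K = ternary ` fst ` R"
  define \<phi> where "\<phi> t = (THE x. (inv ternary t, x) \<in> R)" for t
  have \<phi>: "\<phi> (ternary b) = x" if "(b, x) \<in> R" for b x
    unfolding \<phi>_def using that R_unique inj_ternary by (intro the_equality) auto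
  show ?thesis
  proof
    have "R \<inter> (UNIV \<times> mspace X) = R" by (auto simp: R_def)
    moreover have "closedin (mtopology_of X) (mspace X)"
      by (metis closedin_topspace topspace_mtopology_of)
    ultimately show "compact K" using image_compact[of "mspace X"] unfolding K_def by simp
    then have "closed K" by (rule compact_imp_closed)
    show "K \<subseteq> {0..1}" using ternary_bounds by (auto simp: K_def)
    show "\<phi> ` K = mspace X"
    proof
      show "\<phi> ` K \<subseteq> mspace X" using \<phi> by (auto simp: K_def R_def)
      show "mspace X \<subseteq> \<phi> ` K"
      proof
        fix x assume "x \<in> mspace X"
        then obtain b where "(b, x) \<in> R" using R_total by blast
        then have "ternary b \<in> K" "\<phi> (ternary b) = x" using \<phi> by (force simp: K_def)+
        then show "x \<in> \<phi> ` K" by blast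
      qed
    qed
    show "continuous_map (top_of_set K) (mtopology_of X) \<phi>"
      unfolding continuous_map_closedin
    proof (intro conjI allI impI)
      show "\<phi> \<in> topspace (top_of_set K) \<rightarrow> topspace (mtopology_of X)"
        using \<open>\<phi> ` K = mspace X\<close> by auto
      fix F assume F: "closedin (mtopology_of X) F"
      have "{t \<in> K. \<phi> t \<in> F} = ternary ` fst ` (R \<inter> (UNIV \<times> F))"
        using \<phi> by (force simp: K_def)
      then have "closed {t \<in> K. \<phi> t \<in> F}"
        using image_compact[OF F] by (simp add: compact_imp_closed)
      then show "closedin (top_of_set K) {t \<in> topspace (top_of_set K). \<phi> t \<in> F}"
        by (intro closed_subset) auto
    qed
  qed
qed


section \<open>The Hahn-Banach theorem\<close>

definition sublinear :: "('v::real_vector \<Rightarrow> real) \<Rightarrow> bool" where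
  "sublinear p \<longleftrightarrow> (\<forall>x y. p (x + y) \<le> p x + p y) \<and> (\<forall>c x. c > 0 \<longrightarrow> p (c *\<^sub>R x) = c * p x)"

lemma sublinearD:
  assumes "sublinear p"
  shows "p (x + y) \<le> p x + p y" "c \<ge> 0 \<Longrightarrow> p (c *\<^sub>R x) = c * p x" "p 0 = 0" "- p (- x) \<le> p x"
proof -
  show add: "p (x + y) \<le> p x + p y" for x y using assms by (simp add: sublinear_def)
  have pos: "c > 0 \<Longrightarrow> p (c *\<^sub>R x) = c * p x" for c x using assms by (simp add: sublinear_def)
  show 0: "p 0 = 0" using pos[of 2 0] by simp
  show "c \<ge> 0 \<Longrightarrow> p (c *\<^sub>R x) = c * p x" using pos 0 by (cases "c = 0") auto
  show "- p (- x) \<le> p x" using add[of x "- x"] 0 by simp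
qed

text \<open>The largest sublinear functional below \<open>p\<close> whose value at \<open>- a\<close> is at most \<open>- p a\<close>.\<close>

definition flatten :: "('v::real_vector \<Rightarrow> real) \<Rightarrow> 'v \<Rightarrow> 'v \<Rightarrow> real" where
  "flatten p a x = (INF t\<in>{0..}. p (x + t *\<^sub>R a) - t * p a)"

context
  fixes p :: "'v::real_vector \<Rightarrow> real" and a :: 'v
  assumes p: "sublinear p"
begin

text \<open>A bound independent of \<open>t\<close>, without which the infimum in
  \<open>flatten\<close> would be meaningless.\<close>

lemma flatten_lower: "t \<ge> 0 \<Longrightarrow> - p (- x) \<le> p (x + t *\<^sub>R a) - t * p a"
  using sublinearD(1)[OF p, of "x + t *\<^sub>R a" "- x"] sublinearD(2)[OF p, of t a] by simp

lemma flatten_le: "t \<ge> 0 \<Longrightarrow> flatten p a x \<le> p (x + t *\<^sub>R a) - t * p a"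
  unfolding flatten_def using flatten_lower
  by (intro cINF_lower bdd_belowI2[of _ "- p (- x)"]) auto

lemma flatten_greatest:
  "(\<And>t. t \<ge> 0 \<Longrightarrow> m \<le> p (x + t *\<^sub>R a) - t * p a) \<Longrightarrow> m \<le> flatten p a x"
  unfolding flatten_def by (intro cINF_greatest) auto

text \<open>Parameters add under addition of arguments and rescale under scaling. For homogeneity
  one inequality suffices: applied with \<open>1 / c\<close> it gives the other.\<close>

lemma sublinear_flatten: "sublinear (flatten p a)"
  unfolding sublinear_def
proof (intro conjI allI impI)
  fix x y
  have *: "flatten p a (x + y) \<le> (p (x + t *\<^sub>R a) - t * p a) + (p (y + u *\<^sub>R a) - u * p a)"
    if "t \<ge> 0" "u \<ge> 0" for t u
    using flatten_le[of "t + u" "x + y"] that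
      sublinearD(1)[OF p, of "x + t *\<^sub>R a" "y + u *\<^sub>R a"]
    by (simp add: algebra_simps)
  have "flatten p a (x + y) - flatten p a x \<le> flatten p a y"
  proof (rule flatten_greatest)
    fix u :: real assume "u \<ge> 0"
    then have "flatten p a (x + y) - (p (y + u *\<^sub>R a) - u * p a) \<le> flatten p a x"
      using * by (intro flatten_greatest) (simp add: algebra_simps)
    then show "flatten p a (x + y) - flatten p a x \<le> p (y + u *\<^sub>R a) - u * p a" by simp
  qed
  then show "flatten p a (x + y) \<le> flatten p a x + flatten p a y" by simp
next
  fix c :: real and x assume c: "c > 0"
  have le: "flatten p a (c *\<^sub>R x) \<le> c * flatten p a x" if c: "c > 0" for c x
  proof -
    have "flatten p a (c *\<^sub>R x) / c \<le> flatten p a x"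
    proof (rule flatten_greatest)
      fix t :: real assume "t \<ge> 0"
      then have "flatten p a (c *\<^sub>R x) \<le> p (c *\<^sub>R (x + t *\<^sub>R a)) - c * t * p a"
        using flatten_le[of "c * t" "c *\<^sub>R x"] c by (simp add: scaleR_add_right)
      also have "\<dots> = c * (p (x + t *\<^sub>R a) - t * p a)"
        using c sublinearD(2)[OF p, of c "x + t *\<^sub>R a"] by (simp add: right_diff_distrib)
      finally show "flatten p a (c *\<^sub>R x) / c \<le> p (x + t *\<^sub>R a) - t * p a"
        using c by (simp add: field_simps)
    qed
    then show ?thesis using c by (simp add: field_simps)
  qed
  show "flatten p a (c *\<^sub>R x) = c * flatten p a x"
    using le[OF c, of x] le[of "1 / c" "c *\<^sub>R x"] c by (simp add: field_simps)
qed

end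

text \<open>An infimum of sublinear functionals is not subadditive in general. In a chain, the
  smaller of \<open>q\<close> and \<open>r\<close> serves for both summands.\<close>

lemma sublinear_INF_chain:
  assumes C: "C \<noteq> {}" "\<And>q. q \<in> C \<Longrightarrow> sublinear q" "\<And>q r. q \<in> C \<Longrightarrow> r \<in> C \<Longrightarrow> q \<le> r \<or> r \<le> q"
    and bdd: "\<And>x. bdd_below ((\<lambda>q. q x) ` C)"
  shows "sublinear (\<lambda>x. INF q\<in>C. q x)"
proof -
  define m where "m x = (INF q\<in>C. q x)" for x
  have lower: "m x \<le> q x" if "q \<in> C" for q x
    unfolding m_def using bdd that by (rule cINF_lower)
  have greatest: "z \<le> m x" if "\<And>q. q \<in> C \<Longrightarrow> z \<le> q x" for z x
    unfolding m_def using C(1) that by (rule cINF_greatest)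
  have "m (x + y) \<le> m x + m y" for x y
  proof -
    have *: "m (x + y) \<le> q x + r y" if "q \<in> C" "r \<in> C" for q r
      using C(3)[OF that]
    proof
      assume "q \<le> r"
      then show ?thesis
        using lower[OF that(1), of "x + y"] sublinearD(1)[OF C(2)[OF that(1)], of x y]
          le_funD[of q r y] by linarith
    next
      assume "r \<le> q"
      then show ?thesis
        using lower[OF that(2), of "x + y"] sublinearD(1)[OF C(2)[OF that(2)], of x y]
          le_funD[of r q x] by linarith
    qed
    have "m (x + y) - m x \<le> m y"
    proof (rule greatest)
      fix r assume "r \<in> C"
      then have "m (x + y) - r y \<le> m x"
        using * by (intro greatest) (simp add: algebra_simps)
      then show "m (x + y) - m x \<le> r y" by simp
    qed
    then show ?thesis by simp
  qed
  moreover have "m (c *\<^sub>R x) = c * m x" if c: "c > 0" for c x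
  proof (rule antisym)
    have "m (c *\<^sub>R x) / c \<le> m x"
      using lower[of _ "c *\<^sub>R x"] sublinearD(2)[OF C(2)] c
      by (intro greatest) (fastforce simp: field_simps)
    then show "m (c *\<^sub>R x) \<le> c * m x" using c by (simp add: field_simps)
    show "c * m x \<le> m (c *\<^sub>R x)"
    proof (rule greatest)
      fix q assume "q \<in> C"
      then show "c * m x \<le> q (c *\<^sub>R x)"
        using lower[of q x] sublinearD(2)[OF C(2), of q c x] c by simp
    qed
  qed
  ultimately show ?thesis
    unfolding sublinear_def m_def by blast
qed

text \<open>Zorn's lemma on functionals defined everywhere, in place of partial extensions from
  subspaces. Any sublinear \<open>q \<le> p\<close> satisfies \<open>- p (- x) \<le> q x\<close>, so
  infima over chains are finite.\<close>

lemma minimal_sublinear_exists: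
  assumes p: "sublinear p"
  obtains m where "sublinear m" "m \<le> p" "\<And>q. sublinear q \<Longrightarrow> q \<le> m \<Longrightarrow> q = m"
proof -
  define S where "S = {q. sublinear q \<and> q \<le> p}"
  have "\<exists>m\<in>S. \<forall>q\<in>S. m \<ge> q \<longrightarrow> q = m"
  proof (rule predicate_Zorn)
    show "partial_order_on S (relation_of (\<ge>) S)"
      by (auto intro!: partial_order_on_relation_ofI)
    fix C assume C: "C \<in> Chains (relation_of (\<ge>) S)"
    then have ch: "q \<le> r \<or> r \<le> q" if "q \<in> C" "r \<in> C" for q r
      using that by (auto simp: Chains_def relation_of_def)
    show "\<exists>u\<in>S. \<forall>q\<in>C. q \<ge> u"
    proof (cases "C = {}")
      case True
      then show ?thesis using p by (auto simp: S_def)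
    next
      case False
      have CS: "C \<subseteq> S" using C by (auto simp: Chains_def relation_of_def)
      have "- p (- x) \<le> q x" if "q \<in> C" for q x
        using CS that sublinearD(4)[of q "- x"] le_funD[of q p "- x"] by (force simp: S_def)
      then have bdd: "bdd_below ((\<lambda>q. q x) ` C)" for x by (intro bdd_belowI2) auto
      let ?u = "\<lambda>x. INF q\<in>C. q x"
      have low: "?u \<le> q" if "q \<in> C" for q using that bdd by (auto intro!: le_funI cINF_lower)
      obtain q where "q \<in> C" using False by blast
      then have "?u \<le> p" using low[of q] CS by (auto simp: S_def)
      moreover have "sublinear ?u"
        using CS False bdd ch by (intro sublinear_INF_chain) (auto simp: S_def)
      ultimately show ?thesis using low by (auto simp: S_def)
    qed
  qed
  then obtain m where "m \<in> S" "\<forall>q\<in>S. q \<le> m \<longrightarrow> q = m" by blast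
  then show ?thesis by (intro that[of m]) (auto simp: S_def)
qed

text \<open>A minimal \<open>m\<close> is fixed by every flattening, and the parameter value 1 then
  gives superadditivity. Starting below \<open>flatten p a\<close> instead of \<open>p\<close>
  forces \<open>m (- a) \<le> - p a\<close>, which fixes the value at \<open>a\<close>.\<close>

theorem Hahn_Banach_sublinear:
  assumes p: "sublinear p"
  obtains L where "linear L" "\<And>x. L x \<le> p x" "L a = p a"
proof -
  obtain m where m: "sublinear m" "m \<le> flatten p a"
      and min: "\<And>q. sublinear q \<Longrightarrow> q \<le> m \<Longrightarrow> q = m"
    using minimal_sublinear_exists[OF sublinear_flatten[OF p]] by blast
  have "m (x + y) = m x + m y" for x y
  proof -
    have "flatten m x \<le> m" using flatten_le[OF m(1), of 0] by (auto intro!: le_funI)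
    then have "flatten m x = m" using min sublinear_flatten[OF m(1)] by blast
    then have "m y \<le> m (y + x) - m x" using flatten_le[OF m(1), of 1 x y] by simp
    then show ?thesis
      using sublinearD(1)[OF m(1), of x y] by (simp add: add.commute)
  qed note add = this
  have neg: "m (- x) = - m x" for x using add[of x "- x"] sublinearD(3)[OF m(1)] by simp
  have "m (c *\<^sub>R x) = c * m x" for c x
    using sublinearD(2)[OF m(1), of c x] sublinearD(2)[OF m(1), of "- c" x] neg[of "c *\<^sub>R x"]
    by (cases "c \<ge> 0") auto
  then have "linear m" using add by (intro linearI) auto
  have le: "m x \<le> p x" for x
    using le_funD[OF m(2), of x] flatten_le[OF p, of 0 a x] by simp
  have "m (- a) \<le> - p a"
    using le_funD[OF m(2), of "- a"] flatten_le[OF p, of 1 a "- a"] sublinearD(3)[OF p] by simp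
  then have "m a = p a" using le[of a] neg[of a] by simp
  with \<open>linear m\<close> le show ?thesis by (rule that)
qed


section \<open>Functionals on continuous functions on a compact set of reals\<close>

lemma finite_real_distribution:
  fixes w x :: "nat \<Rightarrow> real"
  assumes w: "finite I" "\<And>i. i \<in> I \<Longrightarrow> w i \<ge> 0" "sum w I = 1"
  obtains M where "real_distribution M"
    "\<And>f :: real \<Rightarrow> real. f \<in> borel_measurable borel \<Longrightarrow> integral\<^sup>L M f = (\<Sum>i\<in>I. w i * f (x i))"
proof -
  let ?P = "point_measure I (\<lambda>i. ennreal (w i))"
  interpret prob_space ?P
  proof
    have "emeasure ?P (space ?P) = (\<Sum>i\<in>I. ennreal (w i))"
      using w(1) by (simp add: emeasure_point_measure_finite space_point_measure)
    also have "\<dots> = ennreal (sum w I)" using w(2) by (rule sum_ennreal)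
    finally show "emeasure ?P (space ?P) = 1" using w(3) by simp
  qed
  have m: "x \<in> measurable ?P borel" by (simp add: measurable_point_measure_eq1)
  show ?thesis
  proof
    show "real_distribution (distr ?P borel x)"
      using m by (rule real_distribution_distr)
    fix f :: "real \<Rightarrow> real" assume f: "f \<in> borel_measurable borel"
    show "integral\<^sup>L (distr ?P borel x) f = (\<Sum>i\<in>I. w i * f (x i))"
      using w by (simp add: integral_distr[OF m f] lebesgue_integral_point_measure_finite)
  qed
qed

text \<open>Helly's theorem wants probability measures. The missing mass is parked at
  \<open>p\<close>, where it is invisible to test functions vanishing there.\<close>

lemma subprobability_completion:
  fixes w x :: "nat \<Rightarrow> real" and p :: real
  assumes w: "\<And>i. i < m \<Longrightarrow> w i \<ge> 0" "(\<Sum>i<m. w i) \<le> 1"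
  obtains M where "real_distribution M"
    "\<And>f :: real \<Rightarrow> real. f \<in> borel_measurable borel \<Longrightarrow>
       integral\<^sup>L M f = (\<Sum>i<m. w i * f (x i)) + (1 - (\<Sum>i<m. w i)) * f p"
proof -
  define w' where "w' i = (if i < m then w i else 1 - (\<Sum>i<m. w i))" for i
  define x' where "x' i = (if i < m then x i else p)" for i
  have "sum w' {..<Suc m} = 1" by (simp add: w'_def)
  moreover have "w' i \<ge> 0" for i using w by (simp add: w'_def)
  ultimately obtain M where M: "real_distribution M"
    "\<And>f :: real \<Rightarrow> real. f \<in> borel_measurable borel \<Longrightarrow>
        integral\<^sup>L M f = (\<Sum>i<Suc m. w' i * f (x' i))"
    using finite_real_distribution[of "{..<Suc m}" w' x'] by blast
  have "(\<Sum>i<Suc m. w' i * f (x' i)) = (\<Sum>i<m. w i * f (x i)) + (1 - (\<Sum>i<m. w i)) * f p"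
    for f :: "real \<Rightarrow> real"
    by (simp add: w'_def x'_def)
  with M that show ?thesis by metis
qed

section \<open>A partition of unity by tent functions on a uniform grid\<close>

definition nodes :: "nat \<Rightarrow> nat set" where
  "nodes n = {..<n + 2}"

definition node :: "nat \<Rightarrow> nat \<Rightarrow> real" where
  "node n k = real k / real (Suc n)"

lemma node_bounds: "k \<in> nodes n \<Longrightarrow> node n k \<in> {0..1}"
  by (auto simp: nodes_def node_def divide_simps)

definition ramp :: "real \<Rightarrow> real" where
  "ramp s = min 1 (max 0 s)"

text \<open>The tent of height 1 at \<open>node n k\<close>, written as a difference of consecutive
  ramps so that sums over \<open>k\<close> telescope.\<close>

definition hat :: "nat \<Rightarrow> nat \<Rightarrow> real \<Rightarrow> real" where
  "hat n k t = ramp (real (Suc n) * t - real k + 1) - ramp (real (Suc n) * t - real k)"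

lemma hat_nonneg: "hat n k t \<ge> 0"
  by (auto simp: hat_def ramp_def)

lemma hat_support: "hat n k t \<noteq> 0 \<Longrightarrow> \<bar>t - node n k\<bar> \<le> 1 / Suc n"
proof -
  assume "hat n k t \<noteq> 0"
  then have "\<bar>real (Suc n) * t - real k\<bar> \<le> 1" by (auto simp: hat_def ramp_def split: if_splits)
  then have "\<bar>real (Suc n) * t - real k\<bar> / Suc n \<le> 1 / Suc n" by (simp add: divide_right_mono)
  moreover have "\<bar>real (Suc n) * t - real k\<bar> / Suc n = \<bar>(real (Suc n) * t - real k) / Suc n\<bar>" by simp
  moreover have "(real (Suc n) * t - real k) / Suc n = t - node n k"
    by (simp add: node_def field_simps)
  ultimately show ?thesis by metis
qed

text \<open>After telescoping, the first ramp has argument at least 1 and the last at most 0. The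
  latter needs the right endpoint of the grid, hence \<open>n + 2\<close> nodes.\<close>

lemma sum_hat:
  assumes "t \<in> {0..1}"
  shows "(\<Sum>k\<in>nodes n. hat n k t) = 1"
proof -
  have "(\<Sum>k<m. hat n k t) = ramp (Suc n * t + 1) - ramp (Suc n * t - m + 1)" for m
    by (induction m) (auto simp: hat_def)
  from this[of "n + 2"] show ?thesis
    using assms mult_left_le[of t "1 + real n"] by (simp add: nodes_def ramp_def algebra_simps)
qed

definition hat_bcontfun :: "nat \<Rightarrow> nat \<Rightarrow> (real \<Rightarrow>\<^sub>C real)" where
  "hat_bcontfun n k = Bcontfun (hat n k)"

lemma apply_hat_bcontfun: "apply_bcontfun (hat_bcontfun n k) = hat n k"
proof -
  have "continuous_on UNIV (hat n k)"
    unfolding hat_def[abs_def] ramp_def by (intro continuous_intros)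
  moreover have "bounded (range (hat n k))"
    by (rule boundedI[of _ 1]) (auto simp: hat_def ramp_def)
  ultimately show ?thesis
    by (simp add: hat_bcontfun_def bcontfun_def Bcontfun_inverse)
qed

text \<open>The functional is approximated by finitely many atoms at the grid points \<open>k / Suc n\<close>, with
  the weights that it gives to the hat functions. Positive and negative parts are completed to
  probability measures by an atom at \<open>2\<close>, outside \<open>K\<close>, and Helly's theorem gives their weak
  limits.\<close>

locale real_functional =
  fixes L :: "(real \<Rightarrow>\<^sub>C real) \<Rightarrow> real" and K :: "real set"
  assumes lin: "linear L" and K: "closed K" "K \<subseteq> {0..1}"
    and bound: "\<And>h s. (\<And>t. t \<in> K \<Longrightarrow> \<bar>apply_bcontfun h t\<bar> \<le> s) \<Longrightarrow> L h \<le> s"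
begin

lemma abs_bound:
  assumes "\<And>t. t \<in> K \<Longrightarrow> \<bar>apply_bcontfun h t\<bar> \<le> s"
  shows "\<bar>L h\<bar> \<le> s"
  using bound[OF assms] bound[of "- h" s] assms linear_neg[OF lin, of h] by simp

text \<open>The bound with \<open>s = 0\<close> shows that \<open>L\<close> sees values on
  \<open>K\<close> only, so it is in effect a functional of norm at most 1 on the continuous
  functions on \<open>K\<close>.\<close>

lemma eq_on:
  assumes "\<And>t. t \<in> K \<Longrightarrow> apply_bcontfun h t = apply_bcontfun g t"
  shows "L h = L g"
  using abs_bound[of "h - g" 0] assms linear_diff[OF lin, of h g] by simp

definition weight :: "nat \<Rightarrow> nat \<Rightarrow> real" where
  "weight n k = L (hat_bcontfun n k)"

lemma L_sum: "L (\<Sum>k\<in>I. c k *\<^sub>R hat_bcontfun n k) = (\<Sum>k\<in>I. c k * weight n k)"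
  by (simp add: linear_sum[OF lin] linear_scale[OF lin] weight_def)

lemma apply_sum:
  "apply_bcontfun (\<Sum>k\<in>I. c k *\<^sub>R hat_bcontfun n k) t = (\<Sum>k\<in>I. c k * hat n k t)"
  by (induction I rule: infinite_finite_induct) (auto simp: apply_hat_bcontfun)

text \<open>Test \<open>L\<close> against the hats weighted by the signs of the weights: this
  function is bounded by 1 on \<open>K\<close> because the hats sum to 1.\<close>

lemma sum_abs_weight: "(\<Sum>k\<in>nodes n. \<bar>weight n k\<bar>) \<le> 1"
proof -
  have "L (\<Sum>k\<in>nodes n. sgn (weight n k) *\<^sub>R hat_bcontfun n k) \<le> 1"
  proof (rule bound)
    fix t assume "t \<in> K"
    have "\<bar>\<Sum>k\<in>nodes n. sgn (weight n k) * hat n k t\<bar> \<le> (\<Sum>k\<in>nodes n. hat n k t)"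
      using hat_nonneg by (intro sum_abs[THEN order_trans] sum_mono) (auto simp: abs_mult abs_sgn_eq)
    then show "\<bar>apply_bcontfun (\<Sum>k\<in>nodes n. sgn (weight n k) *\<^sub>R hat_bcontfun n k) t\<bar> \<le> 1"
      using sum_hat \<open>t \<in> K\<close> K(2) unfolding apply_sum by (metis subsetD)
  qed
  then show ?thesis unfolding L_sum by (simp add: sgn_mult_self_eq mult_sgn_abs abs_sgn mult.commute)
qed

text \<open>Nodes need not lie in \<open>K\<close>. That those with nonzero weight are close to it
  will confine the weak limits.\<close>

lemma weight_support:
  assumes "weight n k \<noteq> 0"
  obtains t where "t \<in> K" "\<bar>t - node n k\<bar> \<le> 1 / Suc n"
proof -
  have "\<exists>t\<in>K. hat n k t \<noteq> 0"
  proof (rule ccontr)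
    assume "\<not> ?thesis"
    then have "\<bar>L (hat_bcontfun n k)\<bar> \<le> 0"
      by (intro abs_bound) (simp add: apply_hat_bcontfun)
    with assms show False by (simp add: weight_def)
  qed
  then show ?thesis using hat_support that by blast
qed

text \<open>The sum is the value of \<open>L\<close> at the piecewise linear interpolant of
  \<open>h\<close>, which converges uniformly to \<open>h\<close> on the unit interval.\<close>

lemma weight_approximation:
  "(\<lambda>n. \<Sum>k\<in>nodes n. apply_bcontfun h (node n k) * weight n k) \<longlonglongrightarrow> L h"
proof (rule LIMSEQ_I)
  fix e :: real assume e: "e > 0"
  have "uniformly_continuous_on {0..1} (apply_bcontfun h)"
    by (intro compact_uniformly_continuous continuous_on_apply_bcontfun) simp
  then obtain d where d: "d > 0"
    "\<And>s t. s \<in> {0..1} \<Longrightarrow> t \<in> {0..1} \<Longrightarrow> \<bar>s - t\<bar> < d \<Longrightarrow> \<bar>h s - h t\<bar> < e / 2"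
    using e unfolding uniformly_continuous_on_def dist_real_def
    by (metis half_gt_zero)
  obtain n0 where n0: "1 / real (Suc n0) < d" using nat_approx_posE[OF d(1)] by auto
  have "\<bar>L h - (\<Sum>k\<in>nodes n. h (node n k) * weight n k)\<bar> \<le> e / 2" if "n \<ge> n0" for n
  proof -
    have n: "1 / real (Suc n) < d"
      using n0 that by (smt (verit) frac_le of_nat_0_less_iff of_nat_mono zero_less_Suc Suc_le_mono)
    have "\<bar>L (h - (\<Sum>k\<in>nodes n. h (node n k) *\<^sub>R hat_bcontfun n k))\<bar> \<le> e / 2"
    proof (rule abs_bound)
      fix t assume "t \<in> K"
      then have t: "t \<in> {0..1}" using K by auto
      have "h t - (\<Sum>k\<in>nodes n. h (node n k) * hat n k t)
          = (\<Sum>k\<in>nodes n. hat n k t) * h t - (\<Sum>k\<in>nodes n. h (node n k) * hat n k t)"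
        using sum_hat[OF t] by simp
      also have "\<dots> = (\<Sum>k\<in>nodes n. hat n k t * (h t - h (node n k)))"
        by (simp add: sum_distrib_left right_diff_distrib sum_subtractf mult.commute)
      also have "\<bar>\<dots>\<bar> \<le> (\<Sum>k\<in>nodes n. hat n k t * (e / 2))"
      proof (intro sum_abs[THEN order_trans] sum_mono)
        fix k assume "k \<in> nodes n"
        then have k: "node n k \<in> {0..1}" by (rule node_bounds)
        show "\<bar>hat n k t * (h t - h (node n k))\<bar> \<le> hat n k t * (e / 2)"
        proof (cases "hat n k t = 0")
          case False
          then have "\<bar>t - node n k\<bar> < d" using hat_support n by fastforce
          then have "\<bar>h t - h (node n k)\<bar> \<le> e / 2" using d(2)[OF t k] by simp
          then show ?thesis unfolding abs_mult abs_of_nonneg[OF hat_nonneg]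
            by (intro mult_left_mono hat_nonneg)
        qed simp
      qed
      also have "\<dots> = e / 2" using sum_hat[OF t, of n] by (simp only: sum_distrib_right[symmetric] mult_1)
      finally show "\<bar>apply_bcontfun (h - (\<Sum>k\<in>nodes n. h (node n k) *\<^sub>R hat_bcontfun n k)) t\<bar> \<le> e / 2"
        by (simp only: minus_bcontfun.rep_eq apply_sum)
    qed
    then show ?thesis by (simp only: linear_diff[OF lin] L_sum)
  qed note close = this
  show "\<exists>n0. \<forall>n\<ge>n0. norm ((\<Sum>k\<in>nodes n. h (node n k) * weight n k) - L h) < e"
  proof (intro exI allI impI)
    fix n assume "n \<ge> n0"
    then show "norm ((\<Sum>k\<in>nodes n. h (node n k) * weight n k) - L h) < e"
      using close[of n] e unfolding real_norm_def by linarith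
  qed
qed

text \<open>Positive part of the weights for \<open>u = 1\<close>, negative part for
  \<open>u = - 1\<close>; the parameter lets one lemma treat both.\<close>

definition part :: "real \<Rightarrow> nat \<Rightarrow> nat \<Rightarrow> real" where
  "part u n k = max 0 (u * weight n k)"

lemma part_measures:
  assumes u: "\<bar>u\<bar> = 1"
  obtains M where "tight M"
    "\<And>n f. f \<in> borel_measurable borel \<Longrightarrow> integral\<^sup>L (M n) f =
       (\<Sum>k\<in>nodes n. part u n k * f (node n k)) + (1 - (\<Sum>k\<in>nodes n. part u n k)) * f (2 :: real)"
    "\<And>n. (\<Sum>k\<in>nodes n. part u n k) \<le> 1"
proof -
  have "part u n k \<le> \<bar>weight n k\<bar>" for n k
    using u by (auto simp: part_def abs_if split: if_splits)
  then have le1: "(\<Sum>k\<in>nodes n. part u n k) \<le> 1" for n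
    using sum_abs_weight[of n] by (meson order_trans sum_mono)
  have "\<exists>M. real_distribution M \<and> (\<forall>f :: real \<Rightarrow> real. f \<in> borel_measurable borel \<longrightarrow>
     integral\<^sup>L M f =
       (\<Sum>k\<in>nodes n. part u n k * f (node n k)) + (1 - (\<Sum>k\<in>nodes n. part u n k)) * f 2)" for n
  proof -
    have "part u n i \<ge> 0" for i by (simp add: part_def)
    then show ?thesis
      by (rule subprobability_completion[of "n + 2" "part u n" "node n" 2])
         (use le1[of n] in \<open>auto simp: nodes_def\<close>)
  qed
  then have "\<exists>M. \<forall>n. real_distribution (M n) \<and> (\<forall>f :: real \<Rightarrow> real. f \<in> borel_measurable borel \<longrightarrow>
     integral\<^sup>L (M n) f =
       (\<Sum>k\<in>nodes n. part u n k * f (node n k)) + (1 - (\<Sum>k\<in>nodes n. part u n k)) * f 2)"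
    by (intro choice allI)
  then obtain M where M: "\<And>n. real_distribution (M n)"
    "\<And>n f. f \<in> borel_measurable borel \<Longrightarrow> integral\<^sup>L (M n) f =
       (\<Sum>k\<in>nodes n. part u n k * f (node n k)) + (1 - (\<Sum>k\<in>nodes n. part u n k)) * f (2 :: real)"
    by blast
  \<comment> \<open>All atoms lie in the unit interval or at 2, so one half-open interval, the shape
    used by \<open>tight\<close>, carries the full mass for every \<open>n\<close>.\<close>
  have M_interval: "measure (M n) {-1<..2} = 1" for n
  proof -
    interpret real_distribution "M n" by (rule M)
    have "measure (M n) {-1<..2} = integral\<^sup>L (M n) (indicator {-1<..2})" by simp
    also have "\<dots> = (\<Sum>k\<in>nodes n. part u n k * indicator {-1<..2} (node n k)) + (1 - (\<Sum>k\<in>nodes n. part u n k)) * 1"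
      by (subst M(2)) auto
    also have "(\<Sum>k\<in>nodes n. part u n k * indicator {-1<..2} (node n k)) = (\<Sum>k\<in>nodes n. part u n k)"
    proof (intro sum.cong refl)
      fix k assume "k \<in> nodes n"
      then have "node n k \<in> {0..1}" by (rule node_bounds)
      then show "part u n k * indicator {-1<..2} (node n k) = part u n k" by (auto simp: indicator_def)
    qed
    finally show ?thesis by simp
  qed
  have "tight M"
    unfolding tight_def
  proof (intro conjI allI impI exI)
    show "real_distribution (M n)" for n by (rule M)
    show "(-1 :: real) < 2" by simp
    show "measure (M n) {-1<..2} > 1 - e" if "e > 0" for n and e :: real
      using M_interval that by simp
  qed
  then show ?thesis using M(2) le1 by (rule that)
qed

text \<open>Weak convergence tests continuous functions, so the truncated distance to
  \<open>insert 2 K\<close> replaces the indicator of the complement. Atoms are at 2 or within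
  \<open>1 / Suc n\<close> of \<open>K\<close>, hence its integral tends to 0.\<close>

lemma weak_limit_concentrated:
  assumes M: "\<And>n. real_distribution (M n)"
    "\<And>n f. f \<in> borel_measurable borel \<Longrightarrow> integral\<^sup>L (M n) f =
       (\<Sum>k\<in>nodes n. part u n k * f (node n k)) + (1 - (\<Sum>k\<in>nodes n. part u n k)) * f (2 :: real)"
    "\<And>n. (\<Sum>k\<in>nodes n. part u n k) \<le> 1"
    and r: "strict_mono r" and A: "real_distribution A" "weak_conv_m (M \<circ> r) A"
  shows "AE t in A. t \<in> insert 2 K"
proof -
  interpret A: real_distribution A by fact
  define \<psi> where "\<psi> t = min 1 (infdist t (insert 2 K))" for t
  have cont: "continuous_on UNIV \<psi>"
    unfolding \<psi>_def by (intro continuous_intros)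
  then have meas: "\<psi> \<in> borel_measurable borel"
    by (rule borel_measurable_continuous_onI)
  have range: "\<psi> t \<ge> 0" "\<psi> t \<le> 1" for t by (auto simp: \<psi>_def infdist_nonneg)
  have "(\<lambda>n. integral\<^sup>L ((M \<circ> r) n) \<psi>) \<longlonglongrightarrow> integral\<^sup>L A \<psi>"
  proof (rule weak_conv_imp_integral_bdd_continuous_conv)
    show "isCont \<psi> x" for x using cont by (simp add: continuous_on_eq_continuous_at)
    show "norm (\<psi> x) \<le> 1" for x using range by simp
  qed (use M A in \<open>auto simp: o_def\<close>)
  moreover have "integral\<^sup>L ((M \<circ> r) n) \<psi> \<le> 1 / Suc n" for n
  proof -
    have "integral\<^sup>L (M n) \<psi> \<le> 1 / Suc n" for n
    proof -
      have "\<psi> 2 = 0" by (simp add: \<psi>_def)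
      then have "integral\<^sup>L (M n) \<psi> = (\<Sum>k\<in>nodes n. part u n k * \<psi> (node n k))"
        using M(2)[OF meas] by simp
      also have "\<dots> \<le> (\<Sum>k\<in>nodes n. part u n k * (1 / Suc n))"
      proof (intro sum_mono)
        fix k
        show "part u n k * \<psi> (node n k) \<le> part u n k * (1 / Suc n)"
        proof (cases "weight n k = 0")
          case False
          then obtain t where t: "t \<in> K" "\<bar>t - node n k\<bar> \<le> 1 / Suc n" using weight_support by blast
          have "\<psi> (node n k) \<le> dist (node n k) t"
            unfolding \<psi>_def using t(1) by (intro min.coboundedI2 infdist_le) auto
          also have "\<dots> \<le> 1 / Suc n" using t(2) by (simp add: dist_real_def abs_minus_commute)
          finally show ?thesis by (intro mult_left_mono) (auto simp: part_def)
        qed (simp add: part_def)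
      qed
      also have "\<dots> = (\<Sum>k\<in>nodes n. part u n k) * (1 / Suc n)" by (simp only: sum_distrib_right)
      also have "\<dots> \<le> 1 * (1 / Suc n)" using M(3) by (intro mult_right_mono) auto
      finally show ?thesis by simp
    qed
    then have "integral\<^sup>L (M (r n)) \<psi> \<le> 1 / Suc (r n)" .
    also have "\<dots> \<le> 1 / Suc n" using seq_suble[OF r, of n] by (simp add: frac_le)
    finally show ?thesis by simp
  qed
  moreover have "(\<lambda>n. 1 / real (Suc n)) \<longlonglongrightarrow> 0" by (rule LIMSEQ_Suc[OF lim_1_over_n])
  ultimately have "integral\<^sup>L A \<psi> \<le> 0" by (meson LIMSEQ_le)
  moreover have "integral\<^sup>L A \<psi> \<ge> 0" using range by (intro integral_nonneg_AE) auto
  moreover have "integrable A \<psi>" using range meas by (intro A.integrable_const_bound[of _ 1]) auto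
  ultimately have "AE t in A. \<psi> t = 0"
    using range integral_nonneg_eq_0_iff_AE[of A \<psi>] by force
  moreover have "t \<in> insert 2 K" if "\<psi> t = 0" for t
    using that K(1) in_closed_iff_infdist_zero[of "insert 2 K" t] by (auto simp: \<psi>_def min_def split: if_splits)
  ultimately show ?thesis by (auto elim: eventually_mono)
qed

theorem representation:
  "\<exists>A D. real_distribution A \<and> real_distribution D \<and>
     (\<forall>h. L h = (\<integral>t. indicator K t * apply_bcontfun h t \<partial>A) - (\<integral>t. indicator K t * apply_bcontfun h t \<partial>D))"
proof -
  define rep where "rep u M \<longleftrightarrow> tight M \<and> (\<forall>n. \<forall>f\<in>borel_measurable borel. integral\<^sup>L (M n) f =
       (\<Sum>k\<in>nodes n. part u n k * f (node n k)) + (1 - (\<Sum>k\<in>nodes n. part u n k)) * f (2 :: real))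
       \<and> (\<forall>n. (\<Sum>k\<in>nodes n. part u n k) \<le> 1)" for u M
  obtain P where P: "rep 1 P"
    by (rule part_measures[of 1]) (auto simp: rep_def)
  obtain N where N: "rep (-1) N"
    by (rule part_measures[of "-1"]) (auto simp: rep_def)
  have "strict_mono (\<lambda>n :: nat. n)" by (simp add: strict_mono_def)
  then obtain r A where A: "strict_mono r" "real_distribution A" "weak_conv_m (P \<circ> (\<lambda>n. n) \<circ> r) A"
    using tight_imp_convergent_subsubsequence P unfolding rep_def by blast
  \<comment> \<open>Extracted along \<open>r\<close>, so that one subsequence \<open>q\<close>
    serves both parts and the difference of the integrals converges.\<close>
  obtain r' D where D: "strict_mono r'" "real_distribution D" "weak_conv_m (N \<circ> r \<circ> r') D"
    using tight_imp_convergent_subsubsequence[OF _ A(1)] N unfolding rep_def by blast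
  define q where "q = r \<circ> r'"
  have q: "strict_mono q" unfolding q_def using A(1) D(1) by (rule strict_mono_o)
  have A': "weak_conv_m (P \<circ> q) A"
    unfolding weak_conv_m_def weak_conv_def
  proof (intro allI impI)
    fix x assume "isCont (cdf A) x"
    then have "(\<lambda>n. cdf (P (r n)) x) \<longlonglongrightarrow> cdf A x"
      using A(3) by (simp add: weak_conv_m_def weak_conv_def)
    from LIMSEQ_subseq_LIMSEQ[OF this D(1)] show "(\<lambda>n. cdf ((P \<circ> q) n) x) \<longlonglongrightarrow> cdf A x"
      by (simp add: q_def o_def)
  qed
  have D': "weak_conv_m (N \<circ> q) D" using D(3) by (simp add: q_def o_assoc)
  have P_distr: "real_distribution (P n)" and N_distr: "real_distribution (N n)" for n
    using P N by (auto simp: rep_def tight_def)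
  have AE_A: "AE t in A. t \<in> insert 2 K"
    using weak_limit_concentrated[of P 1 q A] P P_distr q A(2) A'
    unfolding rep_def by simp
  have AE_D: "AE t in D. t \<in> insert 2 K"
    using weak_limit_concentrated[of N "-1" q D] N N_distr q D(2) D'
    unfolding rep_def by simp
  show ?thesis
  proof (rule exI[of _ A], rule exI[of _ D], intro conjI allI)
    fix h :: "real \<Rightarrow>\<^sub>C real"
    \<comment> \<open>The factor is 1 on \<open>K\<close> and 0 at 2: it does not change
      \<open>L h\<close> and removes the completing atoms, both before the limit and in it.\<close>
    define g where "g t = h t * ramp (2 - t)" for t
    have cont: "continuous_on UNIV g"
      unfolding g_def ramp_def by (intro continuous_intros continuous_on_apply_bcontfun)
    obtain b where b: "\<And>t. norm (h t) \<le> b"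
      using bounded_apply_bcontfun[of h] by (auto simp: bounded_iff)
    have bd: "norm (g t) \<le> b" for t
    proof -
      have "\<bar>ramp (2 - t)\<bar> \<le> 1" by (simp add: ramp_def)
      then have "\<bar>h t\<bar> * \<bar>ramp (2 - t)\<bar> \<le> b * 1"
        using b[of t] by (intro mult_mono) auto
      then show ?thesis by (simp add: g_def abs_mult)
    qed
    then have "g \<in> bcontfun" using cont by (auto simp: bcontfun_def bounded_iff)
    then obtain G where G: "g = apply_bcontfun G" by (rule bcontfunE)
    have gK: "g t = h t" if "t \<in> K" for t using that K(2) by (auto simp: g_def ramp_def)
    then have LG: "L h = L G" by (intro eq_on) (simp add: G)
    have meas: "g \<in> borel_measurable borel" using cont by (rule borel_measurable_continuous_onI)
    have g2: "g 2 = 0" by (simp add: g_def ramp_def)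
    have diff: "integral\<^sup>L (P n) g - integral\<^sup>L (N n) g = (\<Sum>k\<in>nodes n. g (node n k) * weight n k)" for n
    proof -
      have "integral\<^sup>L (P n) g - integral\<^sup>L (N n) g
        = (\<Sum>k\<in>nodes n. part 1 n k * g (node n k)) - (\<Sum>k\<in>nodes n. part (-1) n k * g (node n k))"
        using P N meas g2 unfolding rep_def by simp
      also have "\<dots> = (\<Sum>k\<in>nodes n. g (node n k) * weight n k)"
        unfolding sum_subtractf[symmetric]
        by (intro sum.cong refl) (auto simp: part_def max_def algebra_simps)
      finally show ?thesis .
    qed
    have cont': "isCont g x" for x using cont by (simp add: continuous_on_eq_continuous_at)
    have "(\<lambda>n. integral\<^sup>L ((P \<circ> q) n) g - integral\<^sup>L ((N \<circ> q) n) g) \<longlonglongrightarrow> integral\<^sup>L A g - integral\<^sup>L D g"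
      using P_distr N_distr A(2) D(2) A' D' bd cont'
      by (intro tendsto_diff weak_conv_imp_integral_bdd_continuous_conv) (auto simp: o_def)
    moreover have "(\<lambda>n. integral\<^sup>L ((P \<circ> q) n) g - integral\<^sup>L ((N \<circ> q) n) g) \<longlonglongrightarrow> L G"
      using LIMSEQ_subseq_LIMSEQ[OF weight_approximation[of G] q]
      unfolding G[symmetric] by (simp only: o_def diff)
    ultimately have "L G = integral\<^sup>L A g - integral\<^sup>L D g" by (metis LIMSEQ_unique)
    moreover have restrict: "integral\<^sup>L B g = (\<integral>t. indicator K t * h t \<partial>B)"
      if B: "real_distribution B" "AE t in B. t \<in> insert 2 K" for B
    proof (rule integral_cong_AE)
      interpret real_distribution B by fact
      show "g \<in> borel_measurable B" using meas by simp
      have "apply_bcontfun h \<in> borel_measurable borel"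
        by (intro borel_measurable_continuous_onI continuous_on_apply_bcontfun)
      then show "(\<lambda>t. indicator K t * h t) \<in> borel_measurable B" using K(1) by simp
      have "2 \<notin> K" using K(2) by auto
      then show "AE t in B. g t = indicator K t * h t"
        using B(2) g2 gK by (auto elim!: eventually_mono simp: indicator_def)
    qed
    ultimately show "L h = (\<integral>t. indicator K t * h t \<partial>A) - (\<integral>t. indicator K t * h t \<partial>D)"
      using LG A(2) D(2) AE_A AE_D by simp
  qed fact+
qed

end


section \<open>Regular signed measures on a compact metric space\<close>

lemma finite_disjoint_measure_Union:
  assumes "finite_measure M" "finite P" "P \<subseteq> sets M" "disjoint P"
  shows "measure M (\<Union>P) = (\<Sum>A\<in>P. measure M A)"
proof -
  have "disjoint_family_on (\<lambda>A. A) P"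
    using assms(4) by (simp add: disjoint_family_on_def pairwise_def disjnt_def)
  then show ?thesis
    using finite_measure.finite_measure_finite_Union[OF assms(1,2), of "\<lambda>A. A"] assms(3) by simp
qed

lemma openin_mtopology_subset: "openin (mtopology_of X) U \<Longrightarrow> U \<subseteq> mspace X"
  by (metis openin_subset topspace_mtopology_of)

lemma sigma_algebra_borel_sets_of: "sigma_algebra (mspace X) (borel_sets_of X)"
  unfolding borel_sets_of_def
  by (intro sigma_algebra_sigma_sets) (auto dest: openin_mtopology_subset)

lemma openin_borel_sets_of: "openin (mtopology_of X) U \<Longrightarrow> U \<in> borel_sets_of X"
  by (simp add: borel_sets_of_def sigma_sets.Basic)

lemma closedin_borel_sets_of:
  assumes "closedin (mtopology_of X) C" shows "C \<in> borel_sets_of X"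
proof -
  have "mspace X - C \<in> borel_sets_of X"
    using assms openin_borel_sets_of by (metis closedin_def topspace_mtopology_of)
  then have "mspace X - (mspace X - C) \<in> borel_sets_of X"
    by (simp add: borel_sets_of_def sigma_sets.Compl)
  moreover have "mspace X - (mspace X - C) = C"
    using closedin_subset[OF assms] by auto
  ultimately show ?thesis by simp
qed

lemma compactin_closedin_mtopology:
  "compactin (mtopology_of X) C \<Longrightarrow> closedin (mtopology_of X) C"
  by (metis Metric_space.Hausdorff_space_mtopology Metric_space_mspace_mdist
      compactin_imp_closedin mtopology_of_def)

text \<open>Inner approximation is an assumption here because it will be transported from the line;
  regularity of the difference follows from it.\<close>

locale borel_measure_pair =
  fixes X :: "'a metric" and M N :: "'a measure"
  assumes finM: "finite_measure M" and finN: "finite_measure N"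
    and sets: "sets M = borel_sets_of X" "sets N = borel_sets_of X"
    and innerM: "\<And>E e. E \<in> borel_sets_of X \<Longrightarrow> e > 0 \<Longrightarrow>
        \<exists>C. compactin (mtopology_of X) C \<and> C \<subseteq> E \<and> measure M (E - C) < e"
    and innerN: "\<And>E e. E \<in> borel_sets_of X \<Longrightarrow> e > 0 \<Longrightarrow>
        \<exists>C. compactin (mtopology_of X) C \<and> C \<subseteq> E \<and> measure N (E - C) < e"
begin

interpretation M: finite_measure M by (rule finM)
interpretation N: finite_measure N by (rule finN)
interpretation sigma_algebra "mspace X" "borel_sets_of X" by (rule sigma_algebra_borel_sets_of)

definition \<mu> :: "'a set \<Rightarrow> real" where
  "\<mu> E = measure M E - measure N E"

text \<open>\<open>M\<close> and \<open>N\<close> need not be mutually singular, so this only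
  dominates the total variation of \<open>\<mu>\<close>. Smallness of \<open>\<nu>\<close> is all
  that regularity takes, and no Jordan decomposition is involved.\<close>

definition \<nu> :: "'a set \<Rightarrow> real" where
  "\<nu> E = measure M E + measure N E"

lemma signed_measure: "signed_measure X \<mu>"
  unfolding signed_measure_def \<mu>_def using sets
  by (auto intro!: sums_diff M.finite_measure_UNION N.finite_measure_UNION)

lemma variation_le: "variation X \<mu> E \<le> ennreal (\<nu> E)"
  unfolding variation_def
proof (rule SUP_least)
  fix P assume "P \<in> {P. finite P \<and> P \<subseteq> borel_sets_of X \<and> disjoint P \<and> \<Union>P = E}"
  then have P: "finite P" "P \<subseteq> borel_sets_of X" "disjoint P" "\<Union>P = E" by auto
  have "(\<Sum>A\<in>P. ennreal \<bar>\<mu> A\<bar>) \<le> (\<Sum>A\<in>P. ennreal (\<nu> A))"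
    by (intro sum_mono ennreal_leI)
       (simp add: \<mu>_def \<nu>_def abs_le_iff measure_nonneg add_increasing2)
  also have "\<dots> = ennreal (\<Sum>A\<in>P. \<nu> A)"
    by (intro sum_ennreal) (simp add: \<nu>_def)
  also have "(\<Sum>A\<in>P. \<nu> A) = \<nu> E"
    using finite_disjoint_measure_Union[OF finM P(1) _ P(3)]
      finite_disjoint_measure_Union[OF finN P(1) _ P(3)] P(2,4) sets
    by (simp add: \<nu>_def sum.distrib)
  finally show "(\<Sum>A\<in>P. ennreal \<bar>\<mu> A\<bar>) \<le> ennreal (\<nu> E)" .
qed

text \<open>A partition of \<open>E\<close> extends to one of \<open>U\<close> by the single part
  \<open>U - E\<close>, at the cost of a nonnegative term.\<close>

lemma variation_mono:
  assumes "E \<subseteq> U" "E \<in> borel_sets_of X" "U \<in> borel_sets_of X"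
  shows "variation X \<mu> E \<le> variation X \<mu> U"
proof (cases "E = U")
  case False
  show ?thesis
    unfolding variation_def
  proof (rule SUP_mono)
    fix P assume "P \<in> {P. finite P \<and> P \<subseteq> borel_sets_of X \<and> disjoint P \<and> \<Union>P = E}"
    then have P: "finite P" "P \<subseteq> borel_sets_of X" "disjoint P" "\<Union>P = E" by auto
    have "U - E \<in> borel_sets_of X" using assms by blast
    then have "insert (U - E) P \<in> {P. finite P \<and> P \<subseteq> borel_sets_of X \<and> disjoint P \<and> \<Union>P = U}"
      using P assms(1) by (auto simp: pairwise_insert disjnt_def)
    moreover have "(\<Sum>A\<in>P. ennreal \<bar>\<mu> A\<bar>) \<le> (\<Sum>A\<in>insert (U - E) P. ennreal \<bar>\<mu> A\<bar>)"
      using P(1) by (intro sum_mono2) auto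
    ultimately show "\<exists>Q\<in>{P. finite P \<and> P \<subseteq> borel_sets_of X \<and> disjoint P \<and> \<Union>P = U}.
        (\<Sum>A\<in>P. ennreal \<bar>\<mu> A\<bar>) \<le> (\<Sum>A\<in>Q. ennreal \<bar>\<mu> A\<bar>)" by blast
  qed
qed simp

text \<open>Partitions are sets of sets, and \<open>h\<close> may send several parts to the empty
  set. Disjointness makes this the only failure of injectivity, and such terms vanish.\<close>

lemma partition_sum_le_variation:
  assumes P: "finite P" "P \<subseteq> borel_sets_of X" "disjoint P" "\<Union>P = U"
    and h: "\<And>A. h A \<subseteq> A" "\<And>A. A \<in> P \<Longrightarrow> h A \<in> borel_sets_of X" "(\<Union>A\<in>P. h A) = E"
  shows "(\<Sum>A\<in>P. ennreal \<bar>\<mu> (h A)\<bar>) \<le> variation X \<mu> E"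
proof -
  have disj: "h A \<inter> h B = {}" if "A \<in> P" "B \<in> P" "A \<noteq> B" for A B
    using that P(3) h(1) unfolding pairwise_def disjnt_def by blast
  have "(\<Sum>A\<in>P. ennreal \<bar>\<mu> (h A)\<bar>) = (\<Sum>B\<in>h ` P. ennreal \<bar>\<mu> B\<bar>)"
  proof (subst sum.reindex_nontrivial[OF P(1)])
    fix A B assume "A \<in> P" "B \<in> P" "A \<noteq> B" "h A = h B"
    then have "h A = {}" using disj by blast
    then show "ennreal \<bar>\<mu> (h A)\<bar> = 0" by (simp add: \<mu>_def)
  qed simp
  also have "\<dots> \<le> variation X \<mu> E"
    unfolding variation_def
  proof (rule SUP_upper)
    have "disjoint (h ` P)"
      unfolding pairwise_image using disj by (simp add: pairwise_def disjnt_def)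
    then show "h ` P \<in> {P. finite P \<and> P \<subseteq> borel_sets_of X \<and> disjoint P \<and> \<Union>P = E}"
      using P(1) h(2,3) by auto
  qed
  finally show ?thesis .
qed

lemma variation_subadditive:
  assumes "E \<subseteq> U" "E \<in> borel_sets_of X" "U \<in> borel_sets_of X"
  shows "variation X \<mu> U \<le> variation X \<mu> E + variation X \<mu> (U - E)"
  unfolding variation_def[of X \<mu> U]
proof (rule SUP_least)
  fix P assume "P \<in> {P. finite P \<and> P \<subseteq> borel_sets_of X \<and> disjoint P \<and> \<Union>P = U}"
  then have P: "finite P" "P \<subseteq> borel_sets_of X" "disjoint P" "\<Union>P = U" by auto
  have "ennreal \<bar>\<mu> A\<bar> \<le> ennreal \<bar>\<mu> (A \<inter> E)\<bar> + ennreal \<bar>\<mu> (A - E)\<bar>" if "A \<in> P" for A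
  proof -
    have A: "A \<in> borel_sets_of X" using P(2) that by auto
    have "(A \<inter> E) \<union> (A - E) = A" "(A \<inter> E) \<inter> (A - E) = {}" by auto
    moreover have "A \<inter> E \<in> borel_sets_of X" "A - E \<in> borel_sets_of X"
      using A assms(2) by auto
    ultimately have "\<mu> A = \<mu> (A \<inter> E) + \<mu> (A - E)"
      using M.finite_measure_Union[of "A \<inter> E" "A - E"] N.finite_measure_Union[of "A \<inter> E" "A - E"]
        sets unfolding \<mu>_def by simp
    then show ?thesis by (simp flip: ennreal_plus)
  qed
  then have "(\<Sum>A\<in>P. ennreal \<bar>\<mu> A\<bar>)
      \<le> (\<Sum>A\<in>P. ennreal \<bar>\<mu> (A \<inter> E)\<bar>) + (\<Sum>A\<in>P. ennreal \<bar>\<mu> (A - E)\<bar>)"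
    unfolding sum.distrib[symmetric] by (rule sum_mono)
  also have "\<dots> \<le> variation X \<mu> E + variation X \<mu> (U - E)"
    using P assms by (intro add_mono partition_sum_le_variation) auto
  finally show "(\<Sum>A\<in>P. ennreal \<bar>\<mu> A\<bar>) \<le> variation X \<mu> E + variation X \<mu> (U - E)" .
qed

lemma inner_approximation:
  assumes E: "E \<in> borel_sets_of X" and e: "e > 0"
  obtains C where "compactin (mtopology_of X) C" "C \<subseteq> E" "\<nu> (E - C) \<le> e"
proof -
  obtain C1 where C1: "compactin (mtopology_of X) C1" "C1 \<subseteq> E" "measure M (E - C1) < e / 2"
    using innerM[OF E, of "e / 2"] e by auto
  obtain C2 where C2: "compactin (mtopology_of X) C2" "C2 \<subseteq> E" "measure N (E - C2) < e / 2"
    using innerN[OF E, of "e / 2"] e by auto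
  have C: "C1 \<in> borel_sets_of X" "C2 \<in> borel_sets_of X"
    using C1(1) C2(1) closedin_borel_sets_of compactin_closedin_mtopology by blast+
  have "measure M (E - (C1 \<union> C2)) \<le> measure M (E - C1)"
    "measure N (E - (C1 \<union> C2)) \<le> measure N (E - C2)"
    using E C by (auto intro!: M.finite_measure_mono N.finite_measure_mono simp: sets)
  then have "\<nu> (E - (C1 \<union> C2)) \<le> e" using C1 C2 by (simp add: \<nu>_def)
  moreover have "compactin (mtopology_of X) (C1 \<union> C2)" using C1 C2 by (simp add: compactin_Un)
  ultimately show ?thesis using that C1 C2 by blast
qed

text \<open>By complements: a compact set filling most of \<open>mspace X - E\<close> has an open
  complement that barely exceeds \<open>E\<close>.\<close>

lemma outer_approximation:
  assumes E: "E \<in> borel_sets_of X" and e: "e > 0"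
  obtains U where "openin (mtopology_of X) U" "E \<subseteq> U" "\<nu> (U - E) \<le> e"
proof -
  have sub: "E \<subseteq> mspace X" using E sets_into_space by auto
  obtain C where C: "compactin (mtopology_of X) C" "C \<subseteq> mspace X - E" "\<nu> (mspace X - E - C) \<le> e"
    using inner_approximation[OF compl_sets[OF E] e] by blast
  have "openin (mtopology_of X) (mspace X - C)"
    using compactin_closedin_mtopology[OF C(1)] by (simp add: closedin_def)
  moreover have "(mspace X - C) - E = mspace X - E - C" by auto
  ultimately show ?thesis using that[of "mspace X - C"] C sub by auto
qed

lemma variation_diff_le:
  assumes "E \<subseteq> U" "E \<in> borel_sets_of X" "U \<in> borel_sets_of X" "\<nu> (U - E) \<le> e"
  shows "variation X \<mu> U \<le> variation X \<mu> E + ennreal e"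
  using variation_subadditive[OF assms(1-3)] variation_le[of "U - E"] ennreal_leI[OF assms(4)]
  by (meson add_left_mono order_trans)

lemma regular_measure: "regular_measure X \<mu>"
  unfolding regular_measure_def
proof (intro ballI conjI antisym)
  fix E assume E: "E \<in> borel_sets_of X"
  show "variation X \<mu> E \<le> (INF U\<in>{U. openin (mtopology_of X) U \<and> E \<subseteq> U}. variation X \<mu> U)"
    using E by (intro INF_greatest variation_mono) (auto simp: openin_borel_sets_of)
  show "(SUP K\<in>{K. compactin (mtopology_of X) K \<and> K \<subseteq> E}. variation X \<mu> K) \<le> variation X \<mu> E"
    using E by (intro SUP_least variation_mono)
      (auto simp: closedin_borel_sets_of compactin_closedin_mtopology)
  show "(INF U\<in>{U. openin (mtopology_of X) U \<and> E \<subseteq> U}. variation X \<mu> U) \<le> variation X \<mu> E"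
  proof (rule ennreal_le_epsilon)
    fix e :: real assume "e > 0"
    then obtain U where U: "openin (mtopology_of X) U" "E \<subseteq> U" "\<nu> (U - E) \<le> e"
      using outer_approximation[OF E] by blast
    then show "(INF U\<in>{U. openin (mtopology_of X) U \<and> E \<subseteq> U}. variation X \<mu> U)
        \<le> variation X \<mu> E + ennreal e"
      using variation_diff_le[OF U(2) E openin_borel_sets_of[OF U(1)] U(3)]
      by (intro INF_lower2[of U]) auto
  qed
  show "variation X \<mu> E \<le> (SUP K\<in>{K. compactin (mtopology_of X) K \<and> K \<subseteq> E}. variation X \<mu> K)"
  proof (rule ennreal_le_epsilon)
    fix e :: real assume "e > 0"
    then obtain C where C: "compactin (mtopology_of X) C" "C \<subseteq> E" "\<nu> (E - C) \<le> e"
      using inner_approximation[OF E] by blast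
    then have "variation X \<mu> E \<le> variation X \<mu> C + ennreal e"
      using E closedin_borel_sets_of[OF compactin_closedin_mtopology]
      by (intro variation_diff_le) auto
    also have "\<dots> \<le> (SUP K\<in>{K. compactin (mtopology_of X) K \<and> K \<subseteq> E}. variation X \<mu> K) + ennreal e"
      using C by (intro add_right_mono SUP_upper) auto
    finally show "variation X \<mu> E
      \<le> (SUP K\<in>{K. compactin (mtopology_of X) K \<and> K \<subseteq> E}. variation X \<mu> K) + ennreal e" .
  qed
qed

lemma regular_signed_measure: "\<mu> \<in> regular_signed_measures X"
  using signed_measure regular_measure by (simp add: regular_signed_measures_def)

end

text \<open>Restriction to \<open>K\<close> comes first because \<open>\<phi>\<close> is arbitrary
  elsewhere and the limit measures may charge 2. The target sigma-algebra is generated from the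
  metric, as \<open>'a\<close> carries no topology of its own.\<close>

definition lift_measure :: "'a metric \<Rightarrow> real set \<Rightarrow> (real \<Rightarrow> 'a) \<Rightarrow> real measure \<Rightarrow> 'a measure" where
  "lift_measure X K \<phi> A =
     distr (restrict_space A K) (sigma (mspace X) {U. openin (mtopology_of X) U}) \<phi>"

locale parametrized_space =
  fixes X :: "'a metric" and K :: "real set" and \<phi> :: "real \<Rightarrow> 'a"
  assumes K: "compact K" "K \<subseteq> {0..1}"
    and \<phi>: "continuous_map (top_of_set K) (mtopology_of X) \<phi>" "\<phi> ` K = mspace X"
begin

lemma sets_lift_measure: "sets (lift_measure X K \<phi> A) = borel_sets_of X"
  unfolding lift_measure_def borel_sets_of_def
  by (simp, rule sets_measure_of) (auto dest: openin_mtopology_subset)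

lemma space_lift_measure: "space (lift_measure X K \<phi> A) = mspace X"
  unfolding lift_measure_def by (simp, rule space_measure_of) (auto dest: openin_mtopology_subset)

lemma measurable_\<phi>:
  assumes "sets A = sets borel"
  shows "\<phi> \<in> measurable (restrict_space A K) (sigma (mspace X) {U. openin (mtopology_of X) U})"
proof (rule measurable_measure_of)
  have sp: "space A = UNIV" using sets_eq_imp_space_eq[OF assms] by simp
  show "\<phi> \<in> space (restrict_space A K) \<rightarrow> mspace X"
    using \<phi>(2) by (auto simp: space_restrict_space sp)
  fix U assume "U \<in> {U. openin (mtopology_of X) U}"
  then have "openin (top_of_set K) {t \<in> K. \<phi> t \<in> U}"
    using openin_continuous_map_preimage[OF \<phi>(1), of U] by simp
  then obtain T where "open T" "{t \<in> K. \<phi> t \<in> U} = K \<inter> T" by (auto simp: openin_open)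
  moreover have "\<phi> -` U \<inter> space (restrict_space A K) = {t \<in> K. \<phi> t \<in> U}"
    by (auto simp: space_restrict_space sp)
  ultimately show "\<phi> -` U \<inter> space (restrict_space A K) \<in> sets (restrict_space A K)"
    using assms by (auto simp: sets_restrict_space)
qed (auto dest: openin_mtopology_subset)

context
  fixes A :: "real measure"
  assumes A: "real_distribution A"
begin

interpretation A: real_distribution A by (rule A)

lemma lift_preimage:
  assumes "E \<in> borel_sets_of X"
  shows "\<phi> -` E \<inter> K \<in> sets borel"
    and "measure (lift_measure X K \<phi> A) E = measure A (\<phi> -` E \<inter> K)"
proof -
  have m: "\<phi> \<in> measurable (restrict_space A K) (sigma (mspace X) {U. openin (mtopology_of X) U})"
    by (rule measurable_\<phi>) simp
  have E: "E \<in> sets (sigma (mspace X) {U. openin (mtopology_of X) U})"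
    using assms sets_lift_measure[of A] by (simp add: lift_measure_def)
  have K': "K \<in> sets borel" using K(1) by (simp add: borel_compact)
  have sp: "space (restrict_space A K) = K" by (simp add: space_restrict_space)
  have in_r: "\<phi> -` E \<inter> K \<in> sets (restrict_space A K)"
    using measurable_sets[OF m E] sp by simp
  then show "\<phi> -` E \<inter> K \<in> sets borel"
    using K' by (auto simp: sets_restrict_space)
  show "measure (lift_measure X K \<phi> A) E = measure A (\<phi> -` E \<inter> K)"
    unfolding lift_measure_def using measure_distr[OF m E] sp K'
    by (simp add: measure_restrict_space)
qed

lemma finite_lift_measure: "finite_measure (lift_measure X K \<phi> A)"
proof -
  have "finite_measure (restrict_space A K)"
    using K(1) A.finite_measure_axioms
    by (intro finite_measure_restrict_space) (simp_all add: borel_compact)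
  then show ?thesis
    unfolding lift_measure_def by (rule finite_measure.finite_measure_distr) (simp add: measurable_\<phi>)
qed

lemma inner_regular_lift_measure:
  assumes E: "E \<in> borel_sets_of X" and e: "e > 0"
  shows "\<exists>C. compactin (mtopology_of X) C \<and> C \<subseteq> E \<and> measure (lift_measure X K \<phi> A) (E - C) < e"
proof -
  interpret sigma_algebra "mspace X" "borel_sets_of X" by (rule sigma_algebra_borel_sets_of)
  let ?T = "\<phi> -` E \<inter> K"
  have T: "?T \<in> sets borel" by (rule lift_preimage[OF E])
  have sup: "emeasure A ?T = (SUP C\<in>{C. C \<subseteq> ?T \<and> compact C}. emeasure A C)"
    by (rule inner_regular) (use T in auto)
  obtain C where C: "C \<subseteq> ?T" "compact C" "measure A ?T < measure A C + e"
  \<comment> \<open>If the measure is below \<open>e\<close> the empty set will do; otherwise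
    \<open>measure A ?T - e\<close> is nonnegative and survives the passage to
    \<open>ennreal\<close>.\<close>
  proof (cases "measure A ?T < e")
    case True
    then show ?thesis using that[of "{}"] by simp
  next
    case False
    then have "ennreal (measure A ?T - e) < emeasure A ?T"
      using e unfolding A.emeasure_eq_measure by (intro ennreal_lessI) auto
    then obtain C where "C \<subseteq> ?T" "compact C" "ennreal (measure A ?T - e) < emeasure A C"
      unfolding sup less_SUP_iff by auto
    then show ?thesis
      using that[of C] False by (auto simp: A.emeasure_eq_measure ennreal_less_iff)
  qed
  have "compactin (top_of_set K) C" using C by (auto simp: compactin_subtopology)
  then have img: "compactin (mtopology_of X) (\<phi> ` C)" using \<phi>(1) by (rule image_compactin)
  then have "\<phi> ` C \<in> borel_sets_of X" by (simp add: closedin_borel_sets_of compactin_closedin_mtopology)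
  then have D: "E - \<phi> ` C \<in> borel_sets_of X" using E by auto
  have "measure (lift_measure X K \<phi> A) (E - \<phi> ` C) \<le> measure A (?T - C)"
    unfolding lift_preimage(2)[OF D]
    using T C(2) by (intro A.finite_measure_mono) (auto simp: borel_compact)
  also have "\<dots> = measure A ?T - measure A C"
    using T C by (intro A.finite_measure_Diff) (auto simp: borel_compact)
  also have "\<dots> < e" using C(3) by simp
  finally show ?thesis using img C(1) by (intro exI[of _ "\<phi> ` C"]) auto
qed

lemma integral_lift_measure:
  fixes k :: "'a \<Rightarrow> real"
  assumes k: "k \<in> borel_measurable (lift_measure X K \<phi> A)"
  shows "integral\<^sup>L (lift_measure X K \<phi> A) k = (\<integral>t. indicator K t * k (\<phi> t) \<partial>A)"
proof -
  have "integral\<^sup>L (lift_measure X K \<phi> A) k = (\<integral>t. k (\<phi> t) \<partial>restrict_space A K)"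
    using k unfolding lift_measure_def measurable_distr_eq1
    by (intro integral_distr measurable_\<phi>) auto
  also have "\<dots> = (\<integral>t. indicator K t *\<^sub>R k (\<phi> t) \<partial>A)"
    using K(1) by (intro integral_restrict_space) (simp add: borel_compact)
  finally show ?thesis by simp
qed

end

lemma continuous_map_borel_measurable:
  assumes k: "continuous_map (mtopology_of X) euclideanreal k" and "sets M = borel_sets_of X" "space M = mspace X"
  shows "k \<in> borel_measurable M"
proof (rule borel_measurableI)
  fix S :: "real set" assume "open S"
  then have "openin (mtopology_of X) {x \<in> mspace X. k x \<in> S}"
    using openin_continuous_map_preimage[OF k, of S] by simp
  moreover have "k -` S \<inter> space M = {x \<in> mspace X. k x \<in> S}" using assms(3) by auto
  ultimately show "k -` S \<inter> space M \<in> sets M" using assms(2) by (simp add: openin_borel_sets_of)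
qed

text \<open>Tietze: the functional acts on functions on the whole line, and functions on
  \<open>X\<close> give functions on \<open>K\<close> only. The choice of extension does not matter,
  by \<open>eq_on\<close>.\<close>

lemma bcontfun_lift:
  assumes k: "continuous_map (mtopology_of X) euclideanreal k"
  obtains h :: "real \<Rightarrow>\<^sub>C real" where "\<And>t. t \<in> K \<Longrightarrow> apply_bcontfun h t = k (\<phi> t)"
proof -
  have cont: "continuous_on K (\<lambda>t. k (\<phi> t))"
    using continuous_map_compose[OF \<phi>(1) k] by (simp add: o_def)
  then have "bounded ((\<lambda>t. k (\<phi> t)) ` K)"
    using K(1) compact_continuous_image compact_imp_bounded by blast
  then obtain b where b: "b > 0" "\<And>t. t \<in> K \<Longrightarrow> norm (k (\<phi> t)) \<le> b"
    unfolding bounded_pos by auto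
  obtain g where g: "continuous_on UNIV g" "\<And>t. t \<in> K \<Longrightarrow> g t = k (\<phi> t)" "\<And>t. norm (g t) \<le> b"
    using Tietze[OF cont, of UNIV b] b K(1) by (auto simp: compact_imp_closed)
  then have "g \<in> bcontfun" by (auto simp: bcontfun_def bounded_iff)
  then show ?thesis using g(2) that by (metis bcontfunE)
qed

end


section \<open>Density of shallow networks\<close>

text \<open>This is the distance to \<open>V\<close> measured by \<open>q\<close>; nonnegativity of
  \<open>q\<close> keeps the infimum finite.\<close>

lemma sublinear_quotient:
  assumes q: "sublinear q" "\<And>x. q x \<ge> 0" and V: "subspace V"
  shows "sublinear (\<lambda>x. INF v\<in>V. q (x - v))"
proof -
  define p where "p x = (INF v\<in>V. q (x - v))" for x
  have lower: "p x \<le> q (x - v)" if "v \<in> V" for x v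
    unfolding p_def using that q(2) by (intro cINF_lower bdd_belowI2[of _ 0])
  have greatest: "z \<le> p x" if "\<And>v. v \<in> V \<Longrightarrow> z \<le> q (x - v)" for z x
    unfolding p_def using subspace_0[OF V] that by (intro cINF_greatest) auto
  have "p (x + y) \<le> p x + p y" for x y
  proof -
    have *: "p (x + y) \<le> q (x - v) + q (y - w)" if "v \<in> V" "w \<in> V" for v w
      using lower[of "v + w" "x + y"] subspace_add[OF V that]
        sublinearD(1)[OF q(1), of "x - v" "y - w"]
      by (simp add: algebra_simps)
    have "p (x + y) - p x \<le> p y"
    proof (rule greatest)
      fix w assume "w \<in> V"
      then have "p (x + y) - q (y - w) \<le> p x"
        using * by (intro greatest) (simp add: algebra_simps)
      then show "p (x + y) - p x \<le> q (y - w)" by simp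
    qed
    then show ?thesis by simp
  qed
  moreover have "p (c *\<^sub>R x) = c * p x" if c: "c > 0" for c x
  proof -
    have le: "p (c *\<^sub>R x) \<le> c * p x" if c: "c > 0" for c x
    proof -
      have "p (c *\<^sub>R x) / c \<le> p x"
      proof (rule greatest)
        fix v assume "v \<in> V"
        then have "p (c *\<^sub>R x) \<le> q (c *\<^sub>R (x - v))"
          using lower[of "c *\<^sub>R v" "c *\<^sub>R x"] subspace_scale[OF V] by (simp add: scaleR_diff_right)
        also have "\<dots> = c * q (x - v)" using c sublinearD(2)[OF q(1), of c] by simp
        finally show "p (c *\<^sub>R x) / c \<le> q (x - v)" using c by (simp add: field_simps)
      qed
      then show ?thesis using c by (simp add: field_simps)
    qed
    show ?thesis using le[OF c, of x] le[of "1 / c" "c *\<^sub>R x"] c by (simp add: field_simps)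
  qed
  ultimately show ?thesis unfolding sublinear_def p_def by blast
qed

text \<open>Dominating \<open>L\<close> by the distance to \<open>V\<close> makes it at most 0 at
  both \<open>v\<close> and \<open>- v\<close>, so it vanishes on \<open>V\<close>. Taking 0 in
  \<open>V\<close> bounds it by the seminorm, and its value at \<open>u\<close> is the distance
  itself, at least \<open>e\<close>.\<close>

lemma separating_functional:
  fixes u :: "real \<Rightarrow>\<^sub>C real"
  assumes K: "K \<noteq> {}" and V: "subspace V" and e: "e > 0"
    and far: "\<And>v. v \<in> V \<Longrightarrow> \<exists>t\<in>K. e < \<bar>apply_bcontfun u t - apply_bcontfun v t\<bar>"
  obtains L where "linear L" "\<And>v. v \<in> V \<Longrightarrow> L v = 0" "L u > 0"
    "\<And>h s. (\<And>t. t \<in> K \<Longrightarrow> \<bar>apply_bcontfun h t\<bar> \<le> s) \<Longrightarrow> L h \<le> s"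
proof -
  define q where "q h = (SUP t\<in>K. \<bar>apply_bcontfun h t\<bar>)" for h :: "real \<Rightarrow>\<^sub>C real"
  have upper: "\<bar>apply_bcontfun h t\<bar> \<le> q h" if "t \<in> K" for h t
  proof -
    obtain b where "\<And>t. norm (apply_bcontfun h t) \<le> b"
      using bounded_apply_bcontfun[of h] by (auto simp: bounded_iff)
    then have "bdd_above ((\<lambda>t. \<bar>apply_bcontfun h t\<bar>) ` K)" by (intro bdd_aboveI2[of _ _ b]) simp
    then show ?thesis unfolding q_def using that by (intro cSUP_upper)
  qed
  have least: "q h \<le> s" if "\<And>t. t \<in> K \<Longrightarrow> \<bar>apply_bcontfun h t\<bar> \<le> s" for h s
    unfolding q_def using K that by (intro cSUP_least) auto
  have q0: "q h \<ge> 0" for h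
    using K upper[of _ h] by (meson abs_ge_zero ex_in_conv order_trans)
  have "q (x + y) \<le> q x + q y" for x y
    using upper[of _ x] upper[of _ y]
    by (intro least) (auto intro: order_trans[OF abs_triangle_ineq add_mono])
  moreover have "q (c *\<^sub>R x) = c * q x" if c: "c > 0" for c x
  proof -
    have le: "q (c *\<^sub>R x) \<le> c * q x" if "c > 0" for c x
      using that upper[of _ x] by (intro least) (simp add: abs_mult)
    show ?thesis using le[OF c, of x] le[of "1 / c" "c *\<^sub>R x"] c by (simp add: field_simps)
  qed
  ultimately have q: "sublinear q" by (simp add: sublinear_def)
  define p where "p x = (INF v\<in>V. q (x - v))" for x
  have lower: "p x \<le> q (x - v)" if "v \<in> V" for x v
    unfolding p_def using that q0 by (intro cINF_lower bdd_belowI2[of _ 0])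
  have p: "sublinear p"
    unfolding p_def using q q0 V by (rule sublinear_quotient)
  obtain L where L: "linear L" "\<And>x. L x \<le> p x" "L u = p u"
    using Hahn_Banach_sublinear[OF p] by metis
  show ?thesis
  proof
    have le0: "L v \<le> 0" if "v \<in> V" for v
      using L(2)[of v] lower[OF that, of v] sublinearD(3)[OF q] by simp
    show "L v = 0" if "v \<in> V" for v
      using le0[OF that] le0[OF subspace_neg[OF V that]] linear_neg[OF L(1), of v] by simp
    have "e \<le> p u"
      unfolding p_def
    proof (rule cINF_greatest)
      show "V \<noteq> {}" using subspace_0[OF V] by auto
      fix v assume "v \<in> V"
      then obtain t where t: "t \<in> K" "e < \<bar>apply_bcontfun u t - apply_bcontfun v t\<bar>" using far by blast
      then show "e \<le> q (u - v)" using upper[OF t(1), of "u - v"] by simp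
    qed
    then show "L u > 0" using e L(3) by simp
    show "L h \<le> s" if "\<And>t. t \<in> K \<Longrightarrow> \<bar>apply_bcontfun h t\<bar> \<le> s" for h s
      using L(2)[of h] lower[OF subspace_0[OF V], of h] least[OF that] by simp
  qed fact
qed

section \<open>Sigmoidal functions and indicators of rays\<close>

lemma sigmoidal_bounded:
  assumes "activation \<sigma>" "sigmoidal_type \<sigma>"
  obtains b where "\<And>t. \<bar>\<sigma> t\<bar> \<le> b"
proof -
  have "eventually (\<lambda>t. dist (\<sigma> t) 0 < 1) at_bot" "eventually (\<lambda>t. dist (\<sigma> t) 1 < 1) at_top"
    using assms(2) tendstoD[of \<sigma> 0 at_bot 1] tendstoD[of \<sigma> 1 at_top 1]
    by (auto simp: sigmoidal_type_def)
  then obtain l r where l: "\<And>t. t \<le> l \<Longrightarrow> \<bar>\<sigma> t\<bar> < 1" and r: "\<And>t. t \<ge> r \<Longrightarrow> \<bar>\<sigma> t - 1\<bar> < 1"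
    by (auto simp: eventually_at_bot_linorder eventually_at_top_linorder dist_real_def)
  have "compact (\<sigma> ` {l..r})"
    using assms(1) by (intro compact_continuous_image) (auto simp: activation_def intro: continuous_on_subset)
  then obtain b where b: "\<And>t. t \<in> {l..r} \<Longrightarrow> \<bar>\<sigma> t\<bar> \<le> b"
    using compact_imp_bounded[of "\<sigma> ` {l..r}"] unfolding bounded_iff real_norm_def by blast
  \<comment> \<open>To the right of \<open>r\<close> the value is within 1 of the limit 1, hence the
    2.\<close>
  have "\<bar>\<sigma> t\<bar> \<le> max b 2" for t
    using l[of t] r[of t] b[of t] by (cases "t \<le> l"; cases "t \<ge> r") auto
  then show ?thesis by (rule that)
qed

text \<open>Without the shift by \<open>n\<close> the value at \<open>s = c\<close> would stay at
  \<open>\<sigma> 0\<close>; the shift sends it to 0. The quadratic slope outgrows the shift when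
  \<open>s > c\<close>.\<close>

lemma sigmoidal_limit_indicator:
  assumes "sigmoidal_type \<sigma>"
  shows "(\<lambda>n. \<sigma> ((real n)\<^sup>2 * s + (- (real n)\<^sup>2 * c - real n))) \<longlonglongrightarrow> indicator {c<..} s"
proof (cases "s > c")
  case True
  then have "filterlim (\<lambda>n. (real n)\<^sup>2 * (s - c) - real n) at_top sequentially"
    by real_asymp
  then have "(\<lambda>n. \<sigma> ((real n)\<^sup>2 * (s - c) - real n)) \<longlonglongrightarrow> 1"
    using assms filterlim_compose unfolding sigmoidal_type_def by blast
  then show ?thesis using True by (simp add: algebra_simps)
next
  case False
  then have le: "(real n)\<^sup>2 * (s - c) \<le> 0" for n by (simp add: mult_nonneg_nonpos)
  have "filterlim (\<lambda>n. - real n) at_bot sequentially" by real_asymp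
  then have "filterlim (\<lambda>n. (real n)\<^sup>2 * (s - c) - real n) at_bot sequentially"
    by (rule filterlim_at_bot_mono) (use le in auto)
  then have "(\<lambda>n. \<sigma> ((real n)\<^sup>2 * (s - c) - real n)) \<longlonglongrightarrow> 0"
    using assms filterlim_compose unfolding sigmoidal_type_def by blast
  then show ?thesis using False by (simp add: algebra_simps)
qed

text \<open>Boundedness of \<open>\<sigma>\<close> permits dominated convergence, so the integrals
  determine the measure of every ray \<open>{c<..}\<close>, and finite measures on the line that
  agree on these rays are equal.\<close>

lemma sigmoidal_discriminatory:
  assumes \<sigma>: "activation \<sigma>" "sigmoidal_type \<sigma>"
    and M: "finite_measure M" and N: "finite_measure N"
    and f: "f \<in> borel_measurable M" "f \<in> borel_measurable N"
    and eq: "\<And>l \<theta>. (\<integral>x. \<sigma> (l * f x + \<theta>) \<partial>M) = (\<integral>x. \<sigma> (l * f x + \<theta>) \<partial>N)"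
  shows "distr M borel f = distr N borel f"
proof (rule measure_eqI_lessThan)
  obtain b where b: "\<And>t. \<bar>\<sigma> t\<bar> \<le> b" using sigmoidal_bounded[OF \<sigma>] by blast
  have meas\<sigma>: "\<sigma> \<in> borel_measurable borel"
    using \<sigma>(1) unfolding activation_def by (rule borel_measurable_continuous_onI)
  fix c
  have lim: "(\<lambda>n. \<integral>x. \<sigma> ((real n)\<^sup>2 * f x + (- (real n)\<^sup>2 * c - real n)) \<partial>R)
      \<longlonglongrightarrow> measure R (f -` {c<..} \<inter> space R)"
    if R: "finite_measure R" and m: "f \<in> borel_measurable R" for R
  proof -
    interpret finite_measure R by fact
    have "(\<lambda>n. \<integral>x. \<sigma> ((real n)\<^sup>2 * f x + (- (real n)\<^sup>2 * c - real n)) \<partial>R)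
      \<longlonglongrightarrow> (\<integral>x. indicator {c<..} (f x) \<partial>R)"
    proof (rule integral_dominated_convergence)
      show "(\<lambda>x. indicator {c<..} (f x) :: real) \<in> borel_measurable R" using m by measurable
      show "(\<lambda>x. \<sigma> ((real n)\<^sup>2 * f x + (- (real n)\<^sup>2 * c - real n))) \<in> borel_measurable R" for n
        using m by (intro measurable_compose[OF _ meas\<sigma>] borel_measurable_add borel_measurable_times) auto
      show "integrable R (\<lambda>x. b)" by simp
    qed (use b sigmoidal_limit_indicator[OF \<sigma>(2)] in auto)
    also have "(\<integral>x. indicator {c<..} (f x) \<partial>R) = (\<integral>x. indicator (f -` {c<..} \<inter> space R) x \<partial>R)"
      by (intro Bochner_Integration.integral_cong) (auto simp: indicator_def)
    also have "\<dots> = measure R (f -` {c<..} \<inter> space R)" by simp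
    finally show ?thesis .
  qed
  have "measure M (f -` {c<..} \<inter> space M) = measure N (f -` {c<..} \<inter> space N)"
    using LIMSEQ_unique[OF lim[OF M f(1)]] lim[OF N f(2)] by (simp add: eq)
  then show "emeasure (distr M borel f) {c<..} = emeasure (distr N borel f) {c<..}"
    using f by (simp add: emeasure_distr finite_measure.emeasure_eq_measure[OF M]
        finite_measure.emeasure_eq_measure[OF N])
  show "emeasure (distr M borel f) {c<..} < \<infinity>"
    using f by (simp add: emeasure_distr finite_measure.emeasure_eq_measure[OF M])
qed simp_all

lemma continuous_map_activation:
  assumes "activation \<sigma>" "continuous_map T euclideanreal f"
  shows "continuous_map T euclideanreal (\<lambda>x. \<sigma> (f x + \<theta>))"
proof -
  have "continuous_map T euclideanreal (\<lambda>x. f x + \<theta>)"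
    using assms(2) by (intro continuous_map_add) auto
  moreover have "continuous_map euclideanreal euclideanreal \<sigma>"
    using assms(1) by (simp add: activation_def)
  ultimately have "continuous_map T euclideanreal (\<sigma> \<circ> (\<lambda>x. f x + \<theta>))"
    by (rule continuous_map_compose)
  then show ?thesis by (simp add: o_def)
qed

theorem network_on_dense:
  assumes X: "compact_space (mtopology_of X)" "mspace X \<noteq> {}"
    and F: "F \<subseteq> cont_funs X" "F \<noteq> {}" "separates_measures X F" "closed_under_scaling X F"
    and \<sigma>: "activation \<sigma>" "sigmoidal_type \<sigma>"
    and g: "g \<in> cont_funs X" and e: "e > 0"
  shows "\<exists>h\<in>network_on \<sigma> X F. \<forall>x\<in>mspace X. \<bar>g x - h x\<bar> \<le> e"
proof -
  obtain K :: "real set" and \<phi> where param: "compact K" "K \<subseteq> {0..1}"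
    "continuous_map (top_of_set K) (mtopology_of X) \<phi>" "\<phi> ` K = mspace X"
    using compact_metric_space_image_of_real_compact[OF X] by blast
  interpret parametrized_space X K \<phi> by unfold_locales fact+
  have F_cont: "continuous_map (mtopology_of X) euclideanreal f" if "f \<in> F" for f
    using that F(1) by (auto simp: cont_funs_def)
  have g_cont: "continuous_map (mtopology_of X) euclideanreal g"
    using g by (auto simp: cont_funs_def)
  have node_cont: "continuous_map (mtopology_of X) euclideanreal (\<lambda>x. \<sigma> (f x + \<theta>))"
    if "f \<in> F" for f \<theta>
    using \<sigma>(1) F_cont[OF that] by (rule continuous_map_activation)
  define G where "G = {v. \<exists>f\<in>F. \<exists>\<theta>. \<forall>t\<in>K. apply_bcontfun v t = \<sigma> (f (\<phi> t) + \<theta>)}"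
  obtain u where u: "\<And>t. t \<in> K \<Longrightarrow> apply_bcontfun u t = g (\<phi> t)" using bcontfun_lift[OF g_cont] by blast
  have "\<exists>v\<in>span G. \<forall>t\<in>K. \<bar>apply_bcontfun u t - apply_bcontfun v t\<bar> \<le> e"
  proof (rule ccontr)
    assume "\<not> ?thesis"
    then have far: "\<And>v. v \<in> span G \<Longrightarrow> \<exists>t\<in>K. e < \<bar>apply_bcontfun u t - apply_bcontfun v t\<bar>"
      by (meson not_le)
    have "K \<noteq> {}" using param(4) X(2) by auto
    obtain L where L: "linear L" "\<And>v. v \<in> span G \<Longrightarrow> L v = 0" "L u > 0"
      "\<And>h s. (\<And>t. t \<in> K \<Longrightarrow> \<bar>apply_bcontfun h t\<bar> \<le> s) \<Longrightarrow> L h \<le> s"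
      using separating_functional[OF \<open>K \<noteq> {}\<close> subspace_span e far] by blast
    have "real_functional L K"
    proof (rule real_functional.intro)
      show "closed K" using param(1) by (rule compact_imp_closed)
    qed (fact L(1) param(2) L(4))+
    then interpret real_functional L K .
    obtain A D where A: "real_distribution A" and D: "real_distribution D" and rep:
      "\<And>h. L h = (\<integral>t. indicator K t * apply_bcontfun h t \<partial>A) - (\<integral>t. indicator K t * apply_bcontfun h t \<partial>D)"
      using representation by blast
    define M where "M = lift_measure X K \<phi> A"
    define N where "N = lift_measure X K \<phi> D"
    interpret borel_measure_pair X M N
      unfolding M_def N_def
      using A D finite_lift_measure inner_regular_lift_measure sets_lift_measure
      by (intro borel_measure_pair.intro) simp_all
    have spaces: "space M = mspace X" "space N = mspace X"
      by (simp_all add: M_def N_def space_lift_measure)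
    have meas: "k \<in> borel_measurable M" "k \<in> borel_measurable N"
      if "continuous_map (mtopology_of X) euclideanreal k" for k
      using continuous_map_borel_measurable[OF that] sets spaces by auto
    have L_lift: "L h = integral\<^sup>L M k - integral\<^sup>L N k"
      if k: "continuous_map (mtopology_of X) euclideanreal k" and h: "\<And>t. t \<in> K \<Longrightarrow> apply_bcontfun h t = k (\<phi> t)" for h k
    proof -
      have "(\<lambda>t. indicator K t * apply_bcontfun h t) = (\<lambda>t. indicator K t * k (\<phi> t))"
        using h by (auto simp: indicator_def)
      then show ?thesis
        using rep[of h] meas[OF k] A D
        by (simp add: M_def N_def integral_lift_measure)
    qed
    have pushforward_zero: "pushforward X f \<mu> B = 0" if f: "f \<in> F" and B: "B \<in> sets borel" for f B
    proof -
      have "distr M borel f = distr N borel f"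
      proof (rule sigmoidal_discriminatory[OF \<sigma> finM finN meas[OF F_cont[OF f]]])
        fix l \<theta>
        \<comment> \<open>Absorbs the slope \<open>l\<close> into the family; the restriction keeps
          the function extensional.\<close>
        define f' where "f' = restrict (\<lambda>x. l * f x) (mspace X)"
        have f': "f' \<in> F" using F(4) f by (auto simp: closed_under_scaling_def f'_def)
        obtain h where h: "\<And>t. t \<in> K \<Longrightarrow> apply_bcontfun h t = \<sigma> (f' (\<phi> t) + \<theta>)"
          using bcontfun_lift[OF node_cont[OF f', of \<theta>]] by blast
        then have "h \<in> span G" using f' by (intro span_base) (auto simp: G_def)
        then have "integral\<^sup>L M (\<lambda>x. \<sigma> (f' x + \<theta>)) = integral\<^sup>L N (\<lambda>x. \<sigma> (f' x + \<theta>))"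
          using L(2) L_lift[OF node_cont[OF f'] h] by simp
        moreover have "integral\<^sup>L M (\<lambda>x. \<sigma> (f' x + \<theta>)) = (\<integral>x. \<sigma> (l * f x + \<theta>) \<partial>M)"
          "integral\<^sup>L N (\<lambda>x. \<sigma> (f' x + \<theta>)) = (\<integral>x. \<sigma> (l * f x + \<theta>) \<partial>N)"
          by (auto intro!: Bochner_Integration.integral_cong simp: f'_def spaces)
        ultimately show "(\<integral>x. \<sigma> (l * f x + \<theta>) \<partial>M) = (\<integral>x. \<sigma> (l * f x + \<theta>) \<partial>N)" by simp
      qed
      then have "measure (distr M borel f) B = measure (distr N borel f) B" by simp
      then show ?thesis
        using meas[OF F_cont[OF f]] B
        by (simp add: measure_distr pushforward_def \<mu>_def spaces)
    qed
    then have zero: "\<mu> E = 0" if "E \<in> borel_sets_of X" for E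
      using F(3) regular_signed_measure that unfolding separates_measures_def by blast
    \<comment> \<open>Equality of the two measures turns \<open>L u\<close> into the difference of
      equal integrals of \<open>g\<close>, against \<open>L u > 0\<close>.\<close>
    have "M = N"
    proof (rule measure_eqI)
      fix E assume "E \<in> sets M"
      then have "measure M E = measure N E" using zero[of E] sets by (simp add: \<mu>_def)
      then show "emeasure M E = emeasure N E"
        by (simp add: finite_measure.emeasure_eq_measure[OF finM] finite_measure.emeasure_eq_measure[OF finN])
    qed (simp add: sets)
    then show False using L_lift[OF g_cont u] L(3) by simp
  qed
  then obtain v where v: "v \<in> span G" "\<And>t. t \<in> K \<Longrightarrow> \<bar>apply_bcontfun u t - apply_bcontfun v t\<bar> \<le> e" by blast
  obtain S r where S: "finite S" "S \<subseteq> G" "v = (\<Sum>w\<in>S. r w *\<^sub>R w)"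
    using v(1) unfolding span_explicit by blast
  obtain f \<theta> where f\<theta>: "\<And>w. w \<in> S \<Longrightarrow> f w \<in> F"
    "\<And>w t. w \<in> S \<Longrightarrow> t \<in> K \<Longrightarrow> apply_bcontfun w t = \<sigma> (f w (\<phi> t) + \<theta> w)"
    using S(2) unfolding G_def by (simp add: subset_iff) metis
  \<comment> \<open>The span gives a sum over a finite set, a network a sum over
    \<open>{1..N}\<close>. An empty \<open>S\<close> gives \<open>N = 0\<close>.\<close>
  obtain enum where enum: "bij_betw enum {1..card S} S"
    using ex_bij_betw_nat_finite_1[OF S(1)] by blast
  define h where "h = restrict (\<lambda>x. \<Sum>j=1..card S. r (enum j) * \<sigma> (f (enum j) x + \<theta> (enum j))) (mspace X)"
  have "h \<in> network_on \<sigma> X F"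
  proof -
    have inF: "\<forall>j\<in>{1..card S}. f (enum j) \<in> F" using enum f\<theta>(1) by (auto simp: bij_betw_def)
    show ?thesis
      unfolding network_on_def h_def if_not_P[OF F(2)] mem_Collect_eq
      by (rule exI[of _ "card S"], rule exI[of _ "\<lambda>j. r (enum j)"],
          rule exI[of _ "\<lambda>j. \<theta> (enum j)"], rule exI[of _ "\<lambda>j. f (enum j)"])
         (simp add: inF)
  qed
  moreover have "\<bar>g x - h x\<bar> \<le> e" if x: "x \<in> mspace X" for x
  proof -
    obtain t where t: "t \<in> K" "x = \<phi> t" using param(4) x by blast
    have apply_sum: "apply_bcontfun (\<Sum>w\<in>S'. r w *\<^sub>R w) t = (\<Sum>w\<in>S'. r w * apply_bcontfun w t)" for S'
      by (induction S' rule: infinite_finite_induct) auto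
    have "h x = (\<Sum>w\<in>S. r w * \<sigma> (f w x + \<theta> w))"
      using x sum.reindex_bij_betw[OF enum, of "\<lambda>w. r w * \<sigma> (f w x + \<theta> w)"] by (simp add: h_def)
    also have "\<dots> = apply_bcontfun v t"
      unfolding S(3) apply_sum using f\<theta>(2) t by (intro sum.cong) auto
    finally show ?thesis using v(2)[OF t(1)] u[OF t(1)] t(2) by simp
  qed
  ultimately show ?thesis by blast
qed

section \<open>Passage to the Gromov-Hausdorff topology\<close>

lemma openin_GH0_topology:
  "openin GH0_topology U \<longleftrightarrow> ball_open all_cont_funs GH0_dist U"
  by (simp add: GH0_topology_def openin_ball_topology)

lemma dense_in_iff:
  "dense_in T A \<longleftrightarrow> A \<subseteq> topspace T \<and> (\<forall>U. openin T U \<longrightarrow> U \<noteq> {} \<longrightarrow> A \<inter> U \<noteq> {})"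
  unfolding dense_in_def dense_intersects_open by blast

lemma GH0_dist_same_domain_le:
  assumes "e > 0" "mspace X \<noteq> {}" "\<And>x. x \<in> mspace X \<Longrightarrow> \<bar>g x - f x\<bar> \<le> e"
  shows "GH0_dist (X, f) (X, g) \<le> e"
proof -
  interpret Metric_space "mspace X" "mdist X" by simp
  have "eps_isometry e X X (\<lambda>x. x)"
    using assms(1) by (auto simp: eps_isometry_def intro!: bexI)
  moreover have "sup_norm X (\<lambda>x. g x - f x) \<le> e"
    unfolding sup_norm_def using assms by (intro cSUP_least) auto
  ultimately have "e \<in> {e. e > 0 \<and> (\<exists>i j. eps_isometry e X X i \<and> eps_isometry e X X j \<and>
              sup_norm X (\<lambda>x. g (i x) - f x) \<le> e \<and> sup_norm X (\<lambda>y. g y - f (j y)) \<le> e)}"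
    using assms(1) by (auto intro!: exI[of _ "\<lambda>x. x"])
  then show ?thesis
    unfolding GH0_dist_def by (auto intro!: cInf_lower bdd_belowI[of _ 0])
qed

lemma continuous_map_network_on:
  assumes \<sigma>: "activation \<sigma>" and F: "F \<subseteq> cont_funs X" and h: "h \<in> network_on \<sigma> X F"
  shows "h \<in> cont_funs X"
proof -
  obtain N :: nat and a \<theta> f where fF: "\<forall>j\<in>{1..N}. f j \<in> F"
    and h': "h = restrict (\<lambda>x. \<Sum>j=1..N. a j * \<sigma> (f j x + \<theta> j)) (mspace X)"
    using h by (auto simp: network_on_def split: if_splits)
  have "continuous_map (mtopology_of X) euclideanreal (\<lambda>x. \<Sum>j=1..N. a j * \<sigma> (f j x + \<theta> j))"
  proof (intro continuous_map_sum continuous_map_real_mult)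
    fix j assume "j \<in> {1..N}"
    then have "continuous_map (mtopology_of X) euclideanreal (f j)"
      using fF F by (auto simp: cont_funs_def)
    then show "continuous_map (mtopology_of X) euclideanreal (\<lambda>x. \<sigma> (f j x + \<theta> j))"
      by (rule continuous_map_activation[OF \<sigma>])
  qed auto
  then have "continuous_map (mtopology_of X) euclideanreal h"
    by (rule continuous_map_eq) (simp add: h')
  then show ?thesis by (simp add: cont_funs_def h')
qed

theorem theorem2:
  fixes \<F> :: "('a metric \<times> ('a \<Rightarrow> real)) set" and \<sigma> :: "real \<Rightarrow> real"
  assumes "\<F> \<subseteq> all_cont_funs"
    and "locally_sliceable \<F>"
    and "dense_in GH0_topology (over_domains \<F>)"
    and "activation \<sigma>" and "sigmoidal_type \<sigma>"
    and "dense_in (subtopology GH_topology (domains \<F>))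
           {X \<in> domains \<F>. separates_measures X (slice \<F> X) \<and>
                            closed_under_scaling X (slice \<F> X)}"
  shows "dense_in GH0_topology (network \<sigma> \<F>)"
  unfolding dense_in_iff
proof (intro conjI allI impI)
  have slice: "slice \<F> X \<subseteq> cont_funs X" for X by (auto simp: slice_def)
  have top: "topspace GH0_topology = (all_cont_funs :: ('a metric \<times> ('a \<Rightarrow> real)) set)"
    by (simp add: GH0_topology_def)
  show sub: "network \<sigma> \<F> \<subseteq> topspace GH0_topology"
    unfolding top network_def all_cont_funs_def
    using continuous_map_network_on[OF assms(4) slice] by auto
  fix U :: "('a metric \<times> ('a \<Rightarrow> real)) set"
  assume U: "openin GH0_topology U" "U \<noteq> {}"
  then obtain X f where Xf: "(X, f) \<in> over_domains \<F>" "(X, f) \<in> U"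
    using assms(3) unfolding dense_in_iff by fast
  then have X: "X \<in> domains \<F>" "f \<in> cont_funs X"
    by (auto simp: over_domains_def all_cont_funs_def)
  have "openin (subtopology GH0_topology (over_domains \<F>)) (U \<inter> over_domains \<F>)"
    using U(1) by (auto simp: openin_subtopology)
  then have "neighborhood (subtopology GH0_topology (over_domains \<F>)) (X, f) (U \<inter> over_domains \<F>)"
    using Xf openin_subset unfolding neighborhood_def by blast
  then obtain W where W: "neighborhood (subtopology GH_topology (domains \<F>)) X W"
    "\<forall>X'\<in>W. \<exists>g\<in>cont_funs X'. (X', g) \<in> U \<inter> over_domains \<F>"
    using assms(2) X unfolding locally_sliceable_def by blast
  then obtain W' where W': "openin (subtopology GH_topology (domains \<F>)) W'" "X \<in> W'" "W' \<subseteq> W"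
    unfolding neighborhood_def by blast
  then obtain X' where X': "X' \<in> W'" "X' \<in> domains \<F>"
      "separates_measures X' (slice \<F> X')" "closed_under_scaling X' (slice \<F> X')"
    using assms(6) unfolding dense_in_iff by fast
  obtain g where g: "g \<in> cont_funs X'" "(X', g) \<in> U" using W(2) W'(3) X'(1) by blast
  \<comment> \<open>The ball is centred at \<open>g\<close>, not at \<open>f\<close>: the definition
    of an open set gives a ball about each of its points, so no triangle inequality is
    involved.\<close>
  obtain r where r: "r > 0" "{p \<in> all_cont_funs. GH0_dist (X', g) p < r} \<subseteq> U"
    using U(1) g(2) unfolding openin_GH0_topology ball_open_def by blast
  obtain f' where "(X', f') \<in> \<F>" using X'(2) by (auto simp: domains_def)
  then have "f' \<in> slice \<F> X'" and cX: "X' \<in> compact_mspaces"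
    using assms(1) by (auto simp: slice_def all_cont_funs_def)
  then have ne: "slice \<F> X' \<noteq> {}" by auto
  have comp: "compact_space (mtopology_of X')" "mspace X' \<noteq> {}"
    using cX by (auto simp: compact_mspaces_def)
  \<comment> \<open>Half the radius, because the distance estimate is non-strict while the ball is
    strict.\<close>
  have "r / 2 > 0" using r(1) by simp
  obtain h where h: "h \<in> network_on \<sigma> X' (slice \<F> X')" "\<forall>x\<in>mspace X'. \<bar>g x - h x\<bar> \<le> r / 2"
    using network_on_dense[OF comp slice ne X'(3,4) assms(4,5) g(1) \<open>r / 2 > 0\<close>] by blast
  then have "GH0_dist (X', g) (X', h) \<le> r / 2"
    using \<open>r / 2 > 0\<close> comp(2) by (intro GH0_dist_same_domain_le) (auto simp: abs_minus_commute)
  then have "GH0_dist (X', g) (X', h) < r" using r(1) by simp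
  moreover have "(X', h) \<in> network \<sigma> \<F>" using h(1) cX by (simp add: network_def)
  moreover have "(X', h) \<in> all_cont_funs" using calculation(2) sub top by auto
  ultimately show "network \<sigma> \<F> \<inter> U \<noteq> {}" using r(2) by blast
qed

end
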